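(* Let $G$ be a finitely generated torsion-free soluble group. Then at least one of the following holds: (i) $G$ is virtually abelian; (ii) the derived subgroup $G'$ has a subgroup isomorphic to $\mathbb{Z}^\infty$; (iii) $G$ has a subgroup isomorphic to a proper Gc-group.
   Context: $\mathbb{Z}^\infty$ denotes a free abelian group of countably infinite rank. Conventions: $x^y = y^{-1}xy$, $[x,y]=x^{-1}y^{-1}xy$. For an integer $s \ge 1$ and $\mathbf{c} = (c_0,\ldots,c_s)\in \mathbb{Z}^{s+1}$ with $c_0 \neq 0$, $c_s\neq 0$ and $\gcd(c_0,\ldots,c_s)=1$, let $G(\mathbf{c})$ be the group defined by the presentation $\langle \alpha,\beta \mid [\beta,\beta^{\alpha^i}]\ (i\in\mathbb{Z}),\ \beta^{c_0}(\beta^{\alpha})^{c_1}\cdots(\beta^{\alpha^s})^{c_s}\rangle$. A Gc-group is a group isomorphic to some such $G(\mathbf{c})$. A proper Gc-group is a Gc-group that is not virtually abelian. *)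

theory Defs
  imports "HOL-Algebra.Solvable_Groups" "HOL-Algebra.Free_Abelian_Groups"
begin

section \<open>Group-theoretic notions\<close>

definition finitely_generated_group :: "('a, 'b) monoid_scheme \<Rightarrow> bool" where
  "finitely_generated_group G \<longleftrightarrow>
     group G \<and> (\<exists>S. finite S \<and> S \<subseteq> carrier G \<and> generate G S = carrier G)"

definition torsion_free_group :: "('a, 'b) monoid_scheme \<Rightarrow> bool" where
  "torsion_free_group G \<longleftrightarrow>
     group G \<and> (\<forall>x\<in>carrier G. \<forall>n::nat. n > 0 \<longrightarrow> x [^]\<^bsub>G\<^esub> n = \<one>\<^bsub>G\<^esub> \<longrightarrow> x = \<one>\<^bsub>G\<^esub>)"

definition virtually_abelian :: "('a, 'b) monoid_scheme \<Rightarrow> bool" where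
  "virtually_abelian G \<longleftrightarrow>
     group G \<and> (\<exists>H. subgroup H G \<and> finite (rcosets\<^bsub>G\<^esub> H) \<and> comm_group (G\<lparr>carrier := H\<rparr>))"

abbreviation Z_infinity :: "(nat \<Rightarrow>\<^sub>0 int) monoid" where
  "Z_infinity \<equiv> free_Abelian_group (UNIV :: nat set)"

definition conjugate :: "('a, 'b) monoid_scheme \<Rightarrow> 'a \<Rightarrow> 'a \<Rightarrow> 'a" where
  "conjugate G x y = inv\<^bsub>G\<^esub> y \<otimes>\<^bsub>G\<^esub> x \<otimes>\<^bsub>G\<^esub> y"

definition commutator :: "('a, 'b) monoid_scheme \<Rightarrow> 'a \<Rightarrow> 'a \<Rightarrow> 'a" where
  "commutator G x y = inv\<^bsub>G\<^esub> x \<otimes>\<^bsub>G\<^esub> inv\<^bsub>G\<^esub> y \<otimes>\<^bsub>G\<^esub> x \<otimes>\<^bsub>G\<^esub> y"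

definition normal_closure :: "('a, 'b) monoid_scheme \<Rightarrow> 'a set \<Rightarrow> 'a set" where
  "normal_closure G R = generate G {conjugate G r g |r g. r \<in> R \<and> g \<in> carrier G}"

section \<open>Free groups and presentations\<close>

text \<open>A word is a list of letters; \<open>(x, True)\<close> stands for the generator \<open>x\<close> and
  \<open>(x, False)\<close> for its formal inverse. The free group on all elements of the type
  \<^typ>\<open>'x\<close> consists of the words modulo insertion and deletion of adjacent mutually
  inverse letters.\<close>

type_synonym 'x word = "('x \<times> bool) list"

inductive free_equiv :: "'x word \<Rightarrow> 'x word \<Rightarrow> bool" where
  refl: "free_equiv u u"
| sym: "free_equiv u v \<Longrightarrow> free_equiv v u"
| trans: "free_equiv u v \<Longrightarrow> free_equiv v w \<Longrightarrow> free_equiv u w"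
| cancel: "free_equiv (u @ [(x, e), (x, \<not> e)] @ v) (u @ v)"

definition word_class :: "'x word \<Rightarrow> 'x word set" where
  "word_class u = {v. free_equiv u v}"

definition free_group :: "'x word set monoid" where
  "free_group = \<lparr>carrier = range word_class,
     monoid.mult = (\<lambda>A B. \<Union>u\<in>A. \<Union>v\<in>B. word_class (u @ v)),
     one = word_class []\<rparr>"

definition generator :: "'x \<Rightarrow> 'x word set" where
  "generator x = word_class [(x, True)]"

definition presented_group :: "'x word set set \<Rightarrow> 'x word set set monoid" where
  "presented_group R = free_group Mod normal_closure free_group R"

section \<open>Gc-groups\<close>

datatype Gc_generator = Alpha | Beta

text \<open>The tuple \<open>(c\<^sub>0, \<dots>, c\<^sub>s)\<close> is the list \<open>c\<close> of length \<open>s + 1\<close>.\<close>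

definition Gc_tuple :: "int list \<Rightarrow> bool" where
  "Gc_tuple c \<longleftrightarrow> length c \<ge> 2 \<and> hd c \<noteq> 0 \<and> last c \<noteq> 0 \<and> Gcd (set c) = 1"

definition beta_conj :: "int \<Rightarrow> Gc_generator word set" where
  "beta_conj i = conjugate free_group (generator Beta) (generator Alpha [^]\<^bsub>free_group\<^esub> i)"

definition Gc_relators :: "int list \<Rightarrow> Gc_generator word set set" where
  "Gc_relators c =
     range (\<lambda>i::int. commutator free_group (generator Beta) (beta_conj i))
     \<union> {foldr (\<otimes>\<^bsub>free_group\<^esub>)
           (map (\<lambda>i. beta_conj (int i) [^]\<^bsub>free_group\<^esub> (c ! i)) [0..<length c]) \<one>\<^bsub>free_group\<^esub>}"

definition Gc :: "int list \<Rightarrow> Gc_generator word set set monoid" where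
  "Gc c = presented_group (Gc_relators c)"

definition Gc_group :: "('a, 'b) monoid_scheme \<Rightarrow> bool" where
  "Gc_group G \<longleftrightarrow> group G \<and> (\<exists>c. Gc_tuple c \<and> G \<cong> Gc c)"

definition proper_Gc_group :: "('a, 'b) monoid_scheme \<Rightarrow> bool" where
  "proper_Gc_group G \<longleftrightarrow> Gc_group G \<and> \<not> virtually_abelian G"

section \<open>Well-definedness of the constructions\<close>

lemma free_equiv_append_left: "free_equiv u v \<Longrightarrow> free_equiv (w @ u) (w @ v)"
proof (induction rule: free_equiv.induct)
  case (refl u)
  show ?case by (rule free_equiv.refl)
next
  case (sym u v)
  from sym.IH show ?case by (rule free_equiv.sym)
next
  case (trans u v w')
  from trans.IH show ?case by (rule free_equiv.trans)
next
  case (cancel u x e v)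
  show ?case using free_equiv.cancel[of "w @ u" x e v] by simp
qed

lemma free_equiv_append_right: "free_equiv u v \<Longrightarrow> free_equiv (u @ w) (v @ w)"
proof (induction rule: free_equiv.induct)
  case (refl u)
  show ?case by (rule free_equiv.refl)
next
  case (sym u v)
  from sym.IH show ?case by (rule free_equiv.sym)
next
  case (trans u v w')
  from trans.IH show ?case by (rule free_equiv.trans)
next
  case (cancel u x e v)
  show ?case using free_equiv.cancel[of u x e "v @ w"] by simp
qed

lemma free_equiv_append:
  "free_equiv u u' \<Longrightarrow> free_equiv v v' \<Longrightarrow> free_equiv (u @ v) (u' @ v')"
  by (rule free_equiv.trans[OF free_equiv_append_right free_equiv_append_left])

lemma word_class_eq_iff: "word_class u = word_class v \<longleftrightarrow> free_equiv u v"
proof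
  assume "word_class u = word_class v"
  then have "v \<in> word_class u" by (simp add: word_class_def free_equiv.refl)
  then show "free_equiv u v" by (simp add: word_class_def)
next
  assume uv: "free_equiv u v"
  have "free_equiv u w \<longleftrightarrow> free_equiv v w" for w
    using free_equiv.trans[OF uv] free_equiv.trans[OF free_equiv.sym[OF uv]] by metis
  then show "word_class u = word_class v" by (simp add: word_class_def)
qed

lemma mult_word_class:
  "word_class u \<otimes>\<^bsub>free_group\<^esub> word_class v = word_class (u @ v)"
proof -
  have eq: "word_class (u' @ v') = word_class (u @ v)"
    if "u' \<in> word_class u" "v' \<in> word_class v" for u' v'
  proof -
    have "free_equiv u u'" "free_equiv v v'" using that by (simp_all add: word_class_def)
    then show ?thesis
      unfolding word_class_eq_iff by (rule free_equiv.sym[OF free_equiv_append])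
  qed
  have mem: "u \<in> word_class u" "v \<in> word_class v"
    by (simp_all add: word_class_def free_equiv.refl)
  have "(\<Union>u'\<in>word_class u. \<Union>v'\<in>word_class v. word_class (u' @ v')) =
      (\<Union>u'\<in>word_class u. \<Union>v'\<in>word_class v. word_class (u @ v))"
    using eq by (intro SUP_cong HOL.refl) blast
  also have "\<dots> = word_class (u @ v)" using mem by blast
  finally show ?thesis by (simp add: free_group_def)
qed

lemma one_free_group: "\<one>\<^bsub>free_group\<^esub> = word_class []"
  by (simp add: free_group_def)

lemma carrier_free_group: "carrier free_group = range word_class"
  by (simp add: free_group_def)

definition inv_word :: "'x word \<Rightarrow> 'x word" where
  "inv_word u = rev (map (\<lambda>(x, e). (x, \<not> e)) u)"

lemma inv_word_left: "free_equiv (inv_word u @ u) []"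
proof (induction u)
  case Nil
  then show ?case by (simp add: inv_word_def free_equiv.refl)
next
  case (Cons a u)
  obtain x e where a: "a = (x, e)" by (cases a)
  have "free_equiv (inv_word u @ [(x, \<not> e), (x, \<not> \<not> e)] @ u) (inv_word u @ u)"
    by (rule free_equiv.cancel)
  then have "free_equiv (inv_word (a # u) @ a # u) (inv_word u @ u)"
    by (simp add: inv_word_def a)
  then show ?case using Cons by (rule free_equiv.trans)
qed

lemma group_free_group: "group (free_group :: 'x word set monoid)"
proof (rule groupI)
  fix A :: "'x word set" assume "A \<in> carrier free_group"
  then obtain u where A: "A = word_class u" by (auto simp: carrier_free_group)
  have "word_class (inv_word u) \<otimes>\<^bsub>free_group\<^esub> A = \<one>\<^bsub>free_group\<^esub>"
    by (simp add: A mult_word_class one_free_group word_class_eq_iff inv_word_left)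
  then show "\<exists>B\<in>carrier free_group. B \<otimes>\<^bsub>free_group\<^esub> A = \<one>\<^bsub>free_group\<^esub>"
    by (auto simp: carrier_free_group)
qed (auto simp: carrier_free_group one_free_group mult_word_class)

lemma generator_closed: "generator x \<in> carrier free_group"
  by (simp add: generator_def carrier_free_group)

lemma (in group) normal_closure_normal:
  assumes "R \<subseteq> carrier G"
  shows "normal_closure G R \<lhd> G"
  unfolding normal_closure_def
proof (rule normal_generateI)
  show "{conjugate G r g |r g. r \<in> R \<and> g \<in> carrier G} \<subseteq> carrier G"
    using assms by (auto simp: conjugate_def)
next
  fix h k assume "h \<in> {conjugate G r g |r g. r \<in> R \<and> g \<in> carrier G}" and k: "k \<in> carrier G"
  then obtain r g where h: "h = conjugate G r g" "r \<in> R" "g \<in> carrier G" by blast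
  have "k \<otimes> h \<otimes> inv k = conjugate G r (g \<otimes> inv k)"
    using h k assms by (auto simp: conjugate_def inv_mult_group m_assoc subset_iff)
  then show "k \<otimes> h \<otimes> inv k \<in> {conjugate G r g |r g. r \<in> R \<and> g \<in> carrier G}"
    using h k by blast
qed

lemma group_presented_group:
  assumes "R \<subseteq> carrier free_group"
  shows "group (presented_group R)"
  unfolding presented_group_def
  by (intro normal.factorgroup_is_group group.normal_closure_normal group_free_group assms)

lemma Gc_relators_closed: "Gc_relators c \<subseteq> carrier free_group"
proof -
  interpret F: group "free_group :: Gc_generator word set monoid" by (rule group_free_group)
  have b: "beta_conj i \<in> carrier free_group" for i
    by (simp add: beta_conj_def conjugate_def generator_closed)
  have "foldr (\<otimes>\<^bsub>free_group\<^esub>) xs \<one>\<^bsub>free_group\<^esub> \<in> carrier free_group"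
    if "set xs \<subseteq> carrier free_group" for xs :: "Gc_generator word set list"
    using that by (induction xs) auto
  then have "foldr (\<otimes>\<^bsub>free_group\<^esub>)
      (map (\<lambda>i. beta_conj (int i) [^]\<^bsub>free_group\<^esub> (c ! i)) [0..<length c]) \<one>\<^bsub>free_group\<^esub>
      \<in> carrier free_group"
    using b by (simp add: image_subset_iff F.int_pow_closed)
  moreover have "commutator free_group (generator Beta) (beta_conj i) \<in> carrier free_group" for i
    using b by (simp add: commutator_def generator_closed)
  ultimately show ?thesis
    unfolding Gc_relators_def by blast
qed

lemma group_Gc: "group (Gc c)"
  unfolding Gc_def by (rule group_presented_group[OF Gc_relators_closed])

end

theory Submission
  imports Defs "HOL-Computational_Algebra.Polynomial"
begin

text \<open>Let \<open>a, b\<close> be elements of a torsion-free group such that the conjugates of \<open>b\<close> by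
  powers of \<open>a\<close> commute. They generate a cyclic module over the Laurent polynomial ring, where
  the indeterminate acts as conjugation by \<open>a\<close>. If the annihilator of \<open>b\<close> is zero, then the
  multiples of \<open>x - 1\<close> form a free abelian group of infinite rank inside the derived subgroup.
  Otherwise torsion-freeness and Gauss's lemma make the annihilator principal, generated by a
  primitive \<open>f\<close>. If moreover no positive power of \<open>a\<close> commutes with \<open>b\<close>, then \<open>a\<close> has
  no nontrivial power in the module, so \<open>a\<close> and \<open>b\<close> generate a copy of the Gc-group of the
  coefficients of \<open>f\<close>, which is not virtually abelian. Hence if (ii) and (iii) fail,

    (*) whenever the conjugates of \<open>b\<close> by powers of \<open>a\<close> commute, some positive power of
    \<open>a\<close> commutes with \<open>b\<close>.

  Now climb the derived series from the bottom, keeping a normal subgroup \<open>N\<close> with torsion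
  quotient that meets the current term in an abelian group. Below the top, this intersection \<open>A\<close>
  lies in the derived subgroup, so it has finite rank, and by (*) every element of the group has a
  positive power centralizing \<open>A\<close>. Replacing \<open>N\<close> by its intersection with the centralizer
  of \<open>A\<close>, the intersection with the next term becomes nilpotent of class at most two, and (*)
  makes it abelian. At the top \<open>N\<close> is abelian, and its quotient is finite, being a finitely
  generated soluble torsion group.\<close>

section \<open>Saturated ideals of integer polynomials\<close>

text \<open>A nonzero member of least degree has a primitive part \<open>f\<close>, which saturation
  keeps in \<open>I\<close>. Pseudo-division by \<open>f\<close> and Gauss's lemma then give
  divisibility over the integers. In the application, \<open>sat\<close> comes from torsion-freeness
  and \<open>shift\<close> from the injectivity of conjugation.\<close>

lemma saturated_int_poly_ideal_principal:
  fixes I :: "int poly set"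
  assumes zero: "0 \<in> I"
    and add: "\<And>p q. p \<in> I \<Longrightarrow> q \<in> I \<Longrightarrow> p + q \<in> I"
    and mult: "\<And>p q. p \<in> I \<Longrightarrow> q * p \<in> I"
    and sat: "\<And>n p. smult n p \<in> I \<Longrightarrow> n \<noteq> 0 \<Longrightarrow> p \<in> I"
    and shift: "\<And>p. pCons 0 p \<in> I \<Longrightarrow> p \<in> I"
    and nontriv: "p\<^sub>0 \<in> I" "p\<^sub>0 \<noteq> 0"
  obtains f where "content f = 1" "coeff f 0 \<noteq> 0" "\<And>p. p \<in> I \<longleftrightarrow> f dvd p"
proof -
  define P where "P p \<longleftrightarrow> p \<in> I \<and> p \<noteq> 0" for p
  obtain g where g: "P g" and min: "\<And>p. P p \<Longrightarrow> degree g \<le> degree p"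
    using arg_min_nat_lemma[of P p\<^sub>0 degree] nontriv unfolding P_def by blast
  define f where "f = primitive_part g"
  have gf: "g = smult (content g) f" by (simp add: f_def)
  have "g \<noteq> 0" using g by (simp add: P_def)
  then have c: "content f = 1" by (simp add: f_def)
  have fI: "f \<in> I" using sat[of "content g" f] gf g \<open>g \<noteq> 0\<close> by (auto simp: P_def)
  have f0: "f \<noteq> 0" using c by auto
  have df: "degree f = degree g" by (simp add: f_def)
  have low: "r = 0" if "r \<in> I" "r = 0 \<or> degree r < degree f" for r
  proof (rule ccontr)
    assume "r \<noteq> 0"
    with that min[of r] df show False by (auto simp: P_def)
  qed
  \<comment> \<open>Otherwise \<open>shift\<close> would cancel a factor \<open>x\<close> and leave
    a nonzero member of smaller degree.\<close>
  have c0: "coeff f 0 \<noteq> 0"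
  proof
    assume "coeff f 0 = 0"
    then obtain h where h: "f = pCons 0 h" by (cases f) auto
    with f0 have "h \<noteq> 0" by auto
    then have "degree h < degree f" using h by simp
    with low[OF shift[of h]] h fI \<open>h \<noteq> 0\<close> show False by auto
  qed
  have "f dvd p" if p: "p \<in> I" for p
  proof -
    \<comment> \<open>Dividing over the integers requires scaling \<open>p\<close> by a power
      \<open>k\<close> of the leading coefficient of \<open>f\<close>. The remainder stays in
      \<open>I\<close>, so minimality of the degree kills it.\<close>
    obtain q r where qr: "pseudo_divmod p f = (q, r)" by (cases "pseudo_divmod p f")
    define k where "k = coeff f (degree f) ^ (Suc (degree p) - degree f)"
    have eq: "smult k p = f * q + r" and r: "r = 0 \<or> degree r < degree f"
      using pseudo_divmod[OF f0 qr] by (auto simp: k_def)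
    have k0: "k \<noteq> 0" using f0 by (simp add: k_def)
    have "r = [:k:] * p + (- q) * f" using eq by (simp add: algebra_simps)
    then have "r \<in> I" using add mult p fI by metis
    with low r have "r = 0" by blast
    with eq have eq: "smult k p = f * q" by simp
    \<comment> \<open>Gauss's lemma: as \<open>f\<close> is primitive, the factor \<open>k\<close>
      must divide every coefficient of \<open>q\<close>, so it can be cancelled.\<close>
    then have "normalize k * content p = content q"
      using c by (metis content_smult content_mult mult_1)
    then have "k dvd content q" by (metis dvd_triv_left normalize_dvd_iff)
    then have "[:k:] dvd q" by (simp add: const_poly_dvd_iff_dvd_content)
    then obtain q' where "q = smult k q'" by (auto elim: dvdE)
    with eq have "smult k p = smult k (f * q')" by simp
    then have "p = f * q'" using k0 by (metis smult_cancel)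
    then show ?thesis by simp
  qed
  moreover have "p \<in> I" if "f dvd p" for p
    using that mult[OF fI] by (auto elim!: dvdE simp: mult.commute)
  ultimately have iff: "p \<in> I \<longleftrightarrow> f dvd p" for p by (rule iffI)
  show thesis by (rule that[OF c c0 iff])
qed

section \<open>Cyclic modules generated by conjugation\<close>

context group
begin

lemma conjugate_closed [simp]:
  "x \<in> carrier G \<Longrightarrow> y \<in> carrier G \<Longrightarrow> conjugate G x y \<in> carrier G"
  by (simp add: conjugate_def)

lemma conjugate_one [simp]: "y \<in> carrier G \<Longrightarrow> conjugate G \<one> y = \<one>"
  by (simp add: conjugate_def)

lemma conjugate_by_one [simp]: "x \<in> carrier G \<Longrightarrow> conjugate G x \<one> = x"
  by (simp add: conjugate_def)

lemma mult_inv_mult: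
  assumes "y \<in> carrier G" "z \<in> carrier G"
  shows "y \<otimes> (inv y \<otimes> z) = z" "inv y \<otimes> (y \<otimes> z) = z"
  using assms by (simp_all flip: m_assoc)

lemma conjugate_mult:
  assumes "x \<in> carrier G" "x' \<in> carrier G" "y \<in> carrier G"
  shows "conjugate G (x \<otimes> x') y = conjugate G x y \<otimes> conjugate G x' y"
  using assms by (simp add: conjugate_def m_assoc mult_inv_mult)

lemma conjugate_conjugate:
  assumes "x \<in> carrier G" "y \<in> carrier G" "z \<in> carrier G"
  shows "conjugate G (conjugate G x y) z = conjugate G x (y \<otimes> z)"
  using assms by (simp add: conjugate_def m_assoc inv_mult_group)

lemma conjugate_inv:
  assumes "x \<in> carrier G" "y \<in> carrier G"
  shows "conjugate G (inv x) y = inv (conjugate G x y)"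
  using assms by (simp add: conjugate_def m_assoc inv_mult_group)

lemma conjugate_nat_pow:
  assumes "x \<in> carrier G" "y \<in> carrier G"
  shows "conjugate G (x [^] (n::nat)) y = conjugate G x y [^] n"
  using assms by (induction n) (simp_all add: conjugate_mult)

lemma mult_conjugate:
  assumes "x \<in> carrier G" "y \<in> carrier G"
  shows "y \<otimes> conjugate G x y = x \<otimes> y"
  using assms by (simp add: conjugate_def m_assoc mult_inv_mult)

lemma conjugate_eq_iff:
  assumes "x \<in> carrier G" "y \<in> carrier G"
  shows "conjugate G x y = x \<longleftrightarrow> x \<otimes> y = y \<otimes> x"
  by (metis assms mult_conjugate conjugate_closed Units_eq Units_l_cancel)

lemma conjugate_eq_one_iff:
  assumes "x \<in> carrier G" "y \<in> carrier G"
  shows "conjugate G x y = \<one> \<longleftrightarrow> x = \<one>"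
  by (metis assms mult_conjugate conjugate_one right_cancel one_closed)

lemma commute_inv:
  assumes "x \<in> carrier G" "y \<in> carrier G" "x \<otimes> y = y \<otimes> x"
  shows "x \<otimes> inv y = inv y \<otimes> x"
  using assms by (metis inv_closed inv_solve_left inv_solve_right m_assoc m_closed)

lemma commute_mult:
  assumes "x \<in> carrier G" "y \<in> carrier G" "z \<in> carrier G" "x \<otimes> y = y \<otimes> x" "x \<otimes> z = z \<otimes> x"
  shows "x \<otimes> (y \<otimes> z) = (y \<otimes> z) \<otimes> x"
  using assms by (metis m_assoc)

lemma generate_commute:
  assumes S: "S \<subseteq> carrier G" and x: "x \<in> carrier G" and c: "\<And>s. s \<in> S \<Longrightarrow> x \<otimes> s = s \<otimes> x"
    and y: "y \<in> generate G S"
  shows "x \<otimes> y = y \<otimes> x"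
  using y
proof (induction rule: generate.induct)
  case (inv h)
  then show ?case using commute_inv[of x h] S x c by auto
next
  case (eng h1 h2)
  then show ?case using commute_mult[of x h1 h2] x generate_in_carrier[OF S] by blast
qed (use x c in auto)

lemma generate_pairwise_commute:
  assumes S: "S \<subseteq> carrier G" and c: "\<And>s t. s \<in> S \<Longrightarrow> t \<in> S \<Longrightarrow> s \<otimes> t = t \<otimes> s"
    and x: "x \<in> generate G S" and y: "y \<in> generate G S"
  shows "x \<otimes> y = y \<otimes> x"
proof -
  have "x \<otimes> s = s \<otimes> x" if s: "s \<in> S" for s
    using generate_commute[OF S, of s x] s S c x by (metis subsetD)
  then show ?thesis using generate_commute[OF S _ _ y] generate_in_carrier[OF S x] by blast
qed

end

text \<open>A polynomial with coefficients \<open>c\<^sub>i\<close> is sent to the product of the powers with exponent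
  \<open>c\<^sub>i\<close> of the conjugates of \<open>b\<close> by \<open>a ^ i\<close>, in Horner form: multiplication by the
  indeterminate becomes conjugation by \<open>a\<close>.\<close>

definition conj_eval :: "('a, 'b) monoid_scheme \<Rightarrow> 'a \<Rightarrow> 'a \<Rightarrow> int poly \<Rightarrow> 'a" where
  "conj_eval G a b p =
     fold_coeffs (\<lambda>c y. b [^]\<^bsub>G\<^esub> c \<otimes>\<^bsub>G\<^esub> conjugate G y a) p \<one>\<^bsub>G\<^esub>"

locale two_elements = group +
  fixes a b
  assumes a [simp]: "a \<in> carrier G" and b [simp]: "b \<in> carrier G"
begin

abbreviation "E \<equiv> conj_eval G a b"

lemma E_0 [simp]: "E 0 = \<one>"
  by (simp add: conj_eval_def)

lemma E_pCons: "E (pCons c p) = b [^] c \<otimes> conjugate G (E p) a"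
proof (cases "c = 0 \<and> p = 0")
  case True
  then show ?thesis by simp
next
  case False
  then show ?thesis by (auto simp: conj_eval_def)
qed

lemma E_closed [simp]: "E p \<in> carrier G"
  by (induction p) (simp_all add: E_pCons)

lemma E_shift: "E (pCons 0 p) = conjugate G (E p) a"
  by (simp add: E_pCons)

lemma E_monom: "E (monom 1 k) = conjugate G b (a [^] k)"
proof (induction k)
  case 0
  then show ?case by (simp add: E_pCons monom_0)
next
  case (Suc k)
  then show ?case by (simp add: monom_Suc E_shift conjugate_conjugate)
qed

end

lemma (in group_hom) hom_conjugate:
  "x \<in> carrier G \<Longrightarrow> y \<in> carrier G \<Longrightarrow> h (conjugate G x y) = conjugate H (h x) (h y)"
  by (simp add: conjugate_def)

text \<open>This lets one polynomial be evaluated compatibly in the free group, in its quotient and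
  in the given group.\<close>

lemma (in group_hom) hom_conj_eval:
  assumes "a \<in> carrier G" "b \<in> carrier G"
  shows "h (conj_eval G a b p) = conj_eval H (h a) (h b) p"
proof -
  interpret G: two_elements G a b using assms by unfold_locales
  interpret H: two_elements H "h a" "h b" using assms by unfold_locales auto
  show ?thesis
    by (induction p) (simp_all add: G.E_pCons H.E_pCons hom_conjugate hom_int_pow assms)
qed

section \<open>The module structure on commuting conjugates\<close>

locale commuting_conjugates = two_elements +
  assumes commute: "\<And>i::int. b \<otimes> conjugate G b (a [^] i) = conjugate G b (a [^] i) \<otimes> b"
begin

text \<open>The full Laurent module generated by \<open>b\<close>. The values of \<open>E\<close>
  cover only the part reached by nonnegative powers of \<open>a\<close>.\<close>

definition B where "B = generate G (range (\<lambda>i::int. conjugate G b (a [^] i)))"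

lemma conj_in_carrier: "range (\<lambda>i::int. conjugate G b (a [^] i)) \<subseteq> carrier G"
  by auto

lemma subgroup_B: "subgroup B G"
  unfolding B_def by (rule generate_is_subgroup[OF conj_in_carrier])

text \<open>The locale compares conjugates with \<open>b\<close> only. Conjugating by a power of
  \<open>a\<close> reduces any pair of generators to that case.\<close>

lemma B_commute:
  assumes "x \<in> B" "y \<in> B"
  shows "x \<otimes> y = y \<otimes> x"
proof (rule generate_pairwise_commute[OF conj_in_carrier _ assms[unfolded B_def]], clarify)
  fix i j :: int
  have j: "conjugate G b (a [^] j) = conjugate G (conjugate G b (a [^] (j - i))) (a [^] i)"
    by (simp add: conjugate_conjugate int_pow_mult[symmetric])
  show "conjugate G b (a [^] i) \<otimes> conjugate G b (a [^] j)
      = conjugate G b (a [^] j) \<otimes> conjugate G b (a [^] i)"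
    unfolding j by (simp add: conjugate_mult[symmetric] commute)
qed

lemma conj_b_in_B: "conjugate G b (a [^] (i::int)) \<in> B"
  unfolding B_def by (rule generate.incl) blast

lemma b_in_B [simp]: "b \<in> B"
  using conj_b_in_B[of 0] by simp

lemma B_conjugate:
  assumes "x \<in> B"
  shows "conjugate G x a \<in> B"
  using assms unfolding B_def
proof (induction rule: generate.induct)
  case one
  then show ?case by (simp add: generate.one)
next
  case (incl h)
  then obtain i :: int where "h = conjugate G b (a [^] i)" by blast
  then have "conjugate G h a = conjugate G b (a [^] (i + 1))"
    by (simp add: conjugate_conjugate int_pow_mult)
  then show ?case by (auto intro: generate.incl)
next
  case (inv h)
  then obtain i :: int where "h = conjugate G b (a [^] i)" by blast
  then have "conjugate G (inv h) a = inv (conjugate G b (a [^] (i + 1)))"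
    by (simp add: conjugate_conjugate int_pow_mult conjugate_inv)
  then show ?case by (auto intro: generate.inv)
next
  case (eng h1 h2)
  then show ?case
    using generate_in_carrier[OF conj_in_carrier]
    by (simp add: conjugate_mult generate.eng)
qed

lemma E_in_B [simp]: "E p \<in> B"
  by (induction p)
    (simp_all add: E_pCons subgroup.one_closed[OF subgroup_B] subgroup.m_closed[OF subgroup_B]
      B_conjugate subgroup_int_pow_closed[OF subgroup_B])

lemma E_add: "E (p + q) = E p \<otimes> E q"
proof (induction p q rule: poly_induct2)
  case 0
  then show ?case by simp
next
  case (pCons c p d q)
  let ?p = "conjugate G (E p) a" and ?q = "conjugate G (E q) a"
  \<comment> \<open>The one interchange that additivity of the Horner form requires; both factors
    lie in the abelian group \<open>B\<close>.\<close>
  have "b [^] d \<otimes> ?p = ?p \<otimes> b [^] d"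
    by (rule B_commute) (simp_all add: B_conjugate subgroup_int_pow_closed[OF subgroup_B])
  then have "b [^] c \<otimes> (b [^] d \<otimes> ?p) \<otimes> ?q = b [^] c \<otimes> (?p \<otimes> b [^] d) \<otimes> ?q"
    by simp
  then show ?case
    by (simp add: E_pCons pCons.IH conjugate_mult int_pow_mult m_assoc)
qed

lemma E_minus: "E (- p) = inv (E p)"
  using E_add[of "- p" p] by (simp add: inv_equality)

lemma E_diff: "E (p - q) = E p \<otimes> inv (E q)"
  using E_add[of p "- q"] by (simp add: E_minus)

lemma E_smult: "E (smult c p) = E p [^] c"
proof -
  have nat: "E (smult (int n) p) = E p [^] int n" for n
    by (induction n) (simp_all add: smult_add_left E_add int_pow_mult B_commute[of "E p"]
        subgroup_int_pow_closed[OF subgroup_B])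
  show ?thesis
  proof (cases c rule: int_cases2)
    case (nonneg n)
    then show ?thesis using nat by simp
  next
    case (nonpos n)
    then show ?thesis using nat[of n] by (simp add: E_minus int_pow_neg)
  qed
qed

text \<open>With additivity, this makes the kernel of \<open>E\<close> an ideal.\<close>

lemma E_mult_eq_one: "E f = \<one> \<Longrightarrow> E (q * f) = \<one>"
  by (induction q) (simp_all add: E_add E_smult E_shift)

text \<open>The letter \<open>a\<close> passes \<open>E p\<close> by shifting the polynomial,
  \<open>inv a\<close> joins the trailing power, and \<open>b\<close> crosses that power as a
  monomial of degree \<open>k\<close>. Keeping a power of \<open>a\<close> on each side makes
  ordinary polynomials suffice in place of Laurent ones.\<close>

lemma normal_form_mult:
  fixes m :: int and k :: nat and p :: "int poly"
  defines "x \<equiv> a [^] m \<otimes> E p \<otimes> inv (a [^] k)"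
  shows "x \<otimes> a = a [^] (m + 1) \<otimes> E (pCons 0 p) \<otimes> inv (a [^] k)"
    and "x \<otimes> inv a = a [^] m \<otimes> E p \<otimes> inv (a [^] Suc k)"
    and "x \<otimes> b = a [^] m \<otimes> E (p + monom 1 k) \<otimes> inv (a [^] k)"
    and "x \<otimes> inv b = a [^] m \<otimes> E (p - monom 1 k) \<otimes> inv (a [^] k)"
proof -
  have "inv (a [^] k) \<otimes> a = a \<otimes> inv (a [^] k)"
    using commute_inv[of a "a [^] k"] by (simp add: pow_mult_distrib nat_pow_Suc2[symmetric])
  then have "x \<otimes> a = a [^] m \<otimes> (E p \<otimes> a) \<otimes> inv (a [^] k)"
    by (simp add: x_def m_assoc)
  also have "E p \<otimes> a = a \<otimes> E (pCons 0 p)" by (simp add: E_shift mult_conjugate)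
  finally show "x \<otimes> a = a [^] (m + 1) \<otimes> E (pCons 0 p) \<otimes> inv (a [^] k)"
    by (simp add: int_pow_mult m_assoc)
  have "inv (a [^] k) \<otimes> inv a = inv (a [^] Suc k)"
    by (subst nat_pow_Suc2) (simp_all add: inv_mult_group)
  then show "x \<otimes> inv a = a [^] m \<otimes> E p \<otimes> inv (a [^] Suc k)"
    by (simp add: x_def m_assoc del: nat_pow_Suc)
  have c: "inv (a [^] k) \<otimes> y = conjugate G y (a [^] k) \<otimes> inv (a [^] k)" if "y \<in> carrier G" for y
    using that by (simp add: conjugate_def m_assoc)
  show "x \<otimes> b = a [^] m \<otimes> E (p + monom 1 k) \<otimes> inv (a [^] k)"
    using c[of b] by (simp add: x_def E_add E_monom m_assoc)
  show "x \<otimes> inv b = a [^] m \<otimes> E (p - monom 1 k) \<otimes> inv (a [^] k)"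
    using c[of "inv b"] by (simp add: x_def E_diff E_monom m_assoc conjugate_inv)
qed

end

section \<open>Free abelian subgroups of infinite rank\<close>

context group
begin

lemma comm_group_generate:
  assumes "S \<subseteq> carrier G" and "\<And>s t. s \<in> S \<Longrightarrow> t \<in> S \<Longrightarrow> s \<otimes> t = t \<otimes> s"
  shows "comm_group (G\<lparr>carrier := generate G S\<rparr>)"
proof (rule group.group_comm_groupI)
  show "group (G\<lparr>carrier := generate G S\<rparr>)"
    by (rule subgroup_imp_group[OF generate_is_subgroup[OF assms(1)]])
qed (use generate_pairwise_commute[OF assms] in simp)

text \<open>The universal map sending the basis to \<open>z\<close> is injective: for a nonzero
  kernel element, the largest index \<open>n\<close> in its support would put a nonzero power of
  \<open>z n\<close> into the subgroup generated by the earlier terms.\<close>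

lemma independent_sequence_imp_Z_infinity:
  fixes z :: "nat \<Rightarrow> 'a"
  assumes z: "range z \<subseteq> carrier G"
    and comm: "\<And>i j. z i \<otimes> z j = z j \<otimes> z i"
    and indep: "\<And>n k::nat. k > 0 \<Longrightarrow> z n [^] k \<notin> generate G (z ` {..<n})"
  obtains H where "subgroup H G" "H \<subseteq> generate G (range z)" "G\<lparr>carrier := H\<rparr> \<cong> Z_infinity"
proof -
  define A where "A = generate G (range z)"
  let ?GA = "G\<lparr>carrier := A\<rparr>"
  have A: "subgroup A G" unfolding A_def by (rule generate_is_subgroup[OF z])
  interpret A: comm_group ?GA
    unfolding A_def by (rule comm_group_generate[OF z]) (use comm in blast)
  have "z ` UNIV \<subseteq> carrier ?GA" by (auto simp: A_def intro: generate.incl)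
  then obtain h where h: "h \<in> hom Z_infinity ?GA" and hz: "\<And>x. h (frag_of x) = z x"
    by (rule A.free_Abelian_group_universal) auto
  have hA: "h x \<in> A" for x using hom_in_carrier[OF h, of x] by simp
  have hG: "h \<in> hom Z_infinity G"
    using h subgroup.subset[OF A] by (auto simp: hom_def)
  interpret h: group_hom Z_infinity G h
    by (rule group_hom.intro) (simp_all add: group_hom_axioms_def hG)
  have hadd: "h (x + y) = h x \<otimes> h y" for x y using h.hom_mult[of x y] by simp
  have hneg: "h (- x) = inv (h x)" for x using h.hom_inv[of x] by simp
  have hcmul: "h (frag_cmul c x) = h x [^] c" for c x
    using h.hom_int_pow[of x c] by simp
  have low: "h u \<in> generate G (z ` {..<n})" if u: "Poly_Mapping.keys u \<subseteq> {..<n}" for u n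
  proof -
    have gen: "subgroup (generate G (z ` {..<n})) G"
      by (rule generate_is_subgroup) (use z in blast)
    from u show ?thesis
    proof (rule free_Abelian_group_induct)
      show "h 0 \<in> generate G (z ` {..<n})" using h.hom_one by (simp add: generate.one)
    next
      fix x y assume "h x \<in> generate G (z ` {..<n})" "h y \<in> generate G (z ` {..<n})"
      then show "h (x - y) \<in> generate G (z ` {..<n})"
        using hadd[of x "- y"] subgroup.m_closed[OF gen] subgroup.m_inv_closed[OF gen]
        by (simp add: hneg)
    next
      fix a assume "a \<in> {..<n}"
      then show "h (frag_of a) \<in> generate G (z ` {..<n})"
        by (auto simp: hz intro: generate.incl)
    qed
  qed
  have "u = 0" if hu: "h u = \<one>" for u
  proof (rule ccontr)
    assume "u \<noteq> 0"
    define n where "n = Max (Poly_Mapping.keys u)"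
    define c where "c = Poly_Mapping.lookup u n"
    define v where "v = u - frag_cmul c (frag_of n)"
    have ne: "Poly_Mapping.keys u \<noteq> {}" using \<open>u \<noteq> 0\<close> by simp
    have "n \<in> Poly_Mapping.keys u" unfolding n_def using ne by (intro Max_in) auto
    then have c: "c \<noteq> 0" by (simp add: c_def in_keys_iff)
    have "Poly_Mapping.keys v \<subseteq> {..<n}"
    proof
      fix i assume i: "i \<in> Poly_Mapping.keys v"
      have "Poly_Mapping.lookup v n = 0" by (simp add: v_def c_def lookup_minus)
      then have "i \<noteq> n" using i by (auto simp: in_keys_iff)
      then have "Poly_Mapping.lookup v i = Poly_Mapping.lookup u i"
        by (simp add: v_def lookup_minus)
      then have "i \<in> Poly_Mapping.keys u" using i by (simp add: in_keys_iff)
      then have "i \<le> n" by (simp add: n_def)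
      with \<open>i \<noteq> n\<close> show "i \<in> {..<n}" by simp
    qed
    then have v: "h v \<in> generate G (z ` {..<n})" by (rule low)
    have "u = frag_cmul c (frag_of n) + v" by (simp add: v_def)
    then have "z n [^] c \<otimes> h v = \<one>" using hu hadd hcmul hz by metis
    then have zc: "z n [^] c = inv (h v)"
      using z by (intro inv_equality[symmetric]) (auto simp: range_subsetD)
    have gen: "subgroup (generate G (z ` {..<n})) G"
      by (rule generate_is_subgroup) (use z in blast)
    have zc': "z n [^] c \<in> generate G (z ` {..<n})"
      unfolding zc using subgroup.m_inv_closed[OF gen v] .
    \<comment> \<open>\<open>indep\<close> speaks of positive exponents, so a negative
      \<open>c\<close> is replaced by its absolute value.\<close>
    have "z n [^] int (nat \<bar>c\<bar>) \<in> generate G (z ` {..<n})"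
    proof (cases "c > 0")
      case True
      then show ?thesis using zc' by simp
    next
      case False
      then have "z n [^] int (nat \<bar>c\<bar>) = inv (z n [^] c)"
        using z by (simp add: int_pow_neg range_subsetD)
      then show ?thesis using subgroup.m_inv_closed[OF gen zc'] by simp
    qed
    then have "z n [^] nat \<bar>c\<bar> \<in> generate G (z ` {..<n})" by (simp only: int_pow_int)
    with indep[of "nat \<bar>c\<bar>" n] c show False by simp
  qed
  then have inj: "inj_on h (carrier Z_infinity)"
    using h.inj_on_one_iff by auto
  define H where "H = h ` carrier Z_infinity"
  have H: "subgroup H G" unfolding H_def by (rule h.img_is_subgroup)
  have "h \<in> iso Z_infinity (G\<lparr>carrier := H\<rparr>)"
    using inj hG by (auto simp: iso_def hom_def bij_betw_def H_def)
  then have "G\<lparr>carrier := H\<rparr> \<cong> Z_infinity"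
    using group.iso_sym[OF group_free_Abelian_group] by (auto simp: is_iso_def)
  moreover have "H \<subseteq> A" using hA by (auto simp: H_def)
  ultimately show thesis using H that by (simp add: A_def)
qed

text \<open>If no finite set works, elements are chosen greedily, each with no positive power in the
  subgroup generated by its predecessors. The resulting sequence is independent.\<close>

lemma finite_rank_or_Z_infinity:
  assumes A: "subgroup A G" and comm: "\<And>x y. x \<in> A \<Longrightarrow> y \<in> A \<Longrightarrow> x \<otimes> y = y \<otimes> x"
    and no: "\<And>H. subgroup H G \<Longrightarrow> H \<subseteq> A \<Longrightarrow> \<not> G\<lparr>carrier := H\<rparr> \<cong> Z_infinity"
  obtains X where "finite X" "X \<subseteq> A" "\<forall>x\<in>A. \<exists>k::nat>0. x [^] k \<in> generate G X"
proof (rule ccontr)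
  assume "\<not> thesis"
  with that have "\<exists>x\<in>A. \<forall>k::nat>0. x [^] k \<notin> generate G X" if "finite X" "X \<subseteq> A" for X
    using \<open>finite X\<close> \<open>X \<subseteq> A\<close> by metis
  then obtain f where f: "\<And>X. finite X \<Longrightarrow> X \<subseteq> A \<Longrightarrow>
      f X \<in> A \<and> (\<forall>k::nat>0. f X [^] k \<notin> generate G X)"
    by metis
  \<comment> \<open>\<open>X n\<close> holds the first \<open>n\<close> choices, starting from the
    empty set.\<close>
  define X where "X n = ((\<lambda>Y. insert (f Y) Y) ^^ n) {}" for n
  define z where "z n = f (X n)" for n
  have X: "finite (X n) \<and> X n \<subseteq> A \<and> X n = z ` {..<n}" for n
  proof (induction n)
    case 0
    then show ?case by (simp add: X_def)
  next
    case (Suc n)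
    have "X (Suc n) = insert (z n) (X n)" by (simp add: X_def z_def)
    then show ?case using Suc f[of "X n"] by (auto simp: lessThan_Suc z_def)
  qed
  have zA: "z n \<in> A" for n using f[of "X n"] X[of n] unfolding z_def by blast
  have sub: "A \<subseteq> carrier G" using A by (rule subgroup.subset)
  have indep: "z n [^] k \<notin> generate G (z ` {..<n})" if "k > 0" for n k :: nat
  proof -
    have Xn: "X n = z ` {..<n}" using X by blast
    have "f (X n) [^] k \<notin> generate G (X n)" using f[of "X n"] X[of n] that by blast
    moreover have zn: "z n = f (X n)" by (rule z_def)
    ultimately show ?thesis unfolding zn Xn[symmetric] by blast
  qed
  have zG: "range z \<subseteq> carrier G" using zA sub by blast
  obtain H where "subgroup H G" "H \<subseteq> generate G (range z)" "G\<lparr>carrier := H\<rparr> \<cong> Z_infinity"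
    by (rule independent_sequence_imp_Z_infinity[OF zG comm[OF zA zA] indep])
  moreover have "generate G (range z) \<subseteq> A" by (rule generate_subgroup_incl[OF _ A]) (use zA in blast)
  ultimately show False using no by blast
qed

end

section \<open>Finitely generated soluble torsion groups\<close>

lemma (in group) finite_index_subgroup_finitely_generated:
  assumes S: "finite S" "S \<subseteq> carrier G" "generate G S = carrier G"
    and H: "subgroup H G"
    and T: "finite T" "T \<subseteq> carrier G" "\<And>g. g \<in> carrier G \<Longrightarrow> \<exists>h\<in>H. \<exists>t\<in>T. g = h \<otimes> t"
  obtains S' where "finite S'" "S' \<subseteq> H" "generate G S' = H"
proof -
  define S2 where "S2 = S \<union> m_inv G ` S"
  \<comment> \<open>The identity is adjoined so that \<open>P\<close> below contains
    \<open>\<one>\<close>. \<open>S'\<close> collects the Schreier elements lying in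
    \<open>H\<close>, together with the representatives in \<open>H\<close>: when
    \<open>u \<otimes> t\<close> is in \<open>H\<close> with \<open>u\<close> in \<open>U\<close>,
    then \<open>t\<close> is in \<open>H\<close> too and must be recognized as a member of
    \<open>U\<close>.\<close>
  define T' where "T' = insert \<one> T"
  define C where "C = (\<lambda>(t, s, u). t \<otimes> s \<otimes> inv u) ` (T' \<times> S2 \<times> T')"
  define S' where "S' = H \<inter> (C \<union> T)"
  have fin: "finite S'" using S(1) T(1) by (simp add: S'_def C_def S2_def T'_def)
  have S2: "S2 \<subseteq> carrier G" using S by (auto simp: S2_def)
  have T': "T' \<subseteq> carrier G" using T by (auto simp: T'_def)
  have S'c: "S' \<subseteq> carrier G" using subgroup.subset[OF H] by (auto simp: S'_def)
  define U where "U = generate G S'"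
  have U: "subgroup U G" unfolding U_def by (rule generate_is_subgroup[OF S'c])
  have UH: "U \<subseteq> H" unfolding U_def by (rule generate_subgroup_incl[OF _ H]) (auto simp: S'_def)
  define P where "P = {u \<otimes> t | u t. u \<in> U \<and> t \<in> T'}"
  \<comment> \<open>Schreier's argument: \<open>U T'\<close> is stable under right multiplication by the generators,
    hence it is the whole group.\<close>
  have step: "y \<otimes> s \<in> P" if y: "y \<in> P" and s: "s \<in> S2" for y s
  proof -
    obtain u t where ut: "y = u \<otimes> t" "u \<in> U" "t \<in> T'" using y by (auto simp: P_def)
    have c: "u \<in> carrier G" "t \<in> carrier G" "s \<in> carrier G"
      using ut s T' S2 subgroup.subset[OF U] by auto
    obtain h t' where ht: "h \<in> H" "t' \<in> T" "t \<otimes> s = h \<otimes> t'" using T(3)[of "t \<otimes> s"] c by auto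
    have c': "h \<in> carrier G" "t' \<in> carrier G" using ht T subgroup.subset[OF H] by auto
    have h: "h = t \<otimes> s \<otimes> inv t'" using ht(3) c c' by (simp add: m_assoc)
    have "h \<in> S'" unfolding S'_def C_def using ht(1,2) ut(3) s h by (force simp: T'_def)
    then have "h \<in> U" unfolding U_def by (rule generate.incl)
    then have "u \<otimes> h \<in> U" using ut(2) subgroup.m_closed[OF U] by blast
    moreover have "y \<otimes> s = (u \<otimes> h) \<otimes> t'" using ut ht(3) c c' by (simp add: m_assoc)
    ultimately show ?thesis using ht(2) by (auto simp: P_def T'_def)
  qed
  have Pc: "P \<subseteq> carrier G" using T' subgroup.subset[OF U] by (auto simp: P_def)
  have gen: "\<forall>y\<in>P. y \<otimes> x \<in> P" if "x \<in> generate G S" for x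
    using that
  proof (induction rule: generate.induct)
    case one
    then show ?case using Pc by (auto simp: subset_iff)
  next
    case (incl s)
    then show ?case using step by (auto simp: S2_def)
  next
    case (inv s)
    then show ?case using step by (auto simp: S2_def)
  next
    case (eng x1 x2)
    then have "x1 \<in> carrier G" "x2 \<in> carrier G" using generate_in_carrier[OF S(2)] by auto
    then show ?case using eng.IH Pc by (metis m_assoc subsetD)
  qed
  have "\<one> \<otimes> \<one> \<in> P"
    unfolding P_def using subgroup.one_closed[OF U] by (blast intro: insertI1[of \<one> T, folded T'_def])
  then have "\<one> \<in> P" by simp
  have "H \<subseteq> U"
  proof
    fix h assume h: "h \<in> H"
    then have hc: "h \<in> carrier G" using subgroup.subset[OF H] by auto
    then have "h \<in> P" using gen[of h] S(3) \<open>\<one> \<in> P\<close> by force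
    then obtain u t where ut: "h = u \<otimes> t" "u \<in> U" "t \<in> T'" by (auto simp: P_def)
    have c: "u \<in> carrier G" "t \<in> carrier G" using ut T' subgroup.subset[OF U] by auto
    have "t = inv u \<otimes> h" using ut(1) c by (simp add: mult_inv_mult)
    then have "t \<in> H"
      using h ut(2) UH subgroup.m_closed[OF H] subgroup.m_inv_closed[OF H] by auto
    then have "t \<in> U"
    proof (cases "t = \<one>")
      case True
      then show ?thesis using subgroup.one_closed[OF U] by simp
    next
      case False
      with ut(3) \<open>t \<in> H\<close> have "t \<in> S'" by (simp add: S'_def T'_def)
      then show ?thesis unfolding U_def by (rule generate.incl)
    qed
    then show "h \<in> U" unfolding ut(1) using ut(2) subgroup.m_closed[OF U] by blast
  qed
  with UH have "generate G S' = H" by (simp add: U_def)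
  moreover have "S' \<subseteq> H" by (simp add: S'_def)
  ultimately show thesis using that fin by blast
qed

text \<open>Induction on the generators: adding \<open>x\<close> to a finite group \<open>D\<close>
  yields only products of a power of \<open>x\<close> and an element of \<open>D\<close>.\<close>

lemma (in comm_group) finite_generate_torsion:
  assumes "finite S" "S \<subseteq> carrier G" "\<And>x. x \<in> S \<Longrightarrow> \<exists>k::nat>0. x [^] k = \<one>"
  shows "finite (generate G S)"
  using assms
proof (induction S rule: finite_induct)
  case empty
  then show ?case by (simp add: generate_empty)
next
  case (insert x F)
  define D where "D = generate G F"
  have F: "F \<subseteq> carrier G" and x: "x \<in> carrier G" using insert.prems by auto
  have D: "subgroup D G" unfolding D_def by (rule generate_is_subgroup[OF F])
  have Dc: "y \<in> D \<Longrightarrow> y \<in> carrier G" for y using subgroup.subset[OF D] by auto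
  have finD: "finite D" unfolding D_def using insert by auto
  obtain k :: nat where k: "k > 0" "x [^] k = \<one>" using insert.prems(2)[of x] by blast
  define P where "P = {x [^] (i::int) \<otimes> y | i y. y \<in> D}"
  have "subgroup P G"
  proof (rule subgroupI)
    show "P \<subseteq> carrier G" using x Dc by (auto simp: P_def)
    show "P \<noteq> {}" using subgroup.one_closed[OF D] by (auto simp: P_def)
    fix g assume "g \<in> P"
    then obtain i :: int and y where g: "g = x [^] i \<otimes> y" "y \<in> D" by (auto simp: P_def)
    have "inv g = x [^] (- i) \<otimes> inv y"
      using x Dc[OF g(2)] by (simp add: g inv_mult int_pow_neg)
    then show "inv g \<in> P" using subgroup.m_inv_closed[OF D g(2)] unfolding P_def by blast
    fix g' assume "g' \<in> P"
    then obtain j :: int and y' where g': "g' = x [^] j \<otimes> y'" "y' \<in> D" by (auto simp: P_def)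
    have "g \<otimes> g' = x [^] (i + j) \<otimes> (y \<otimes> y')"
      using x Dc[OF g(2)] Dc[OF g'(2)] by (simp add: g g' int_pow_mult m_ac)
    then show "g \<otimes> g' \<in> P" using subgroup.m_closed[OF D g(2) g'(2)] unfolding P_def by blast
  qed
  moreover have "insert x F \<subseteq> P"
  proof -
    have "x = x [^] (1::int) \<otimes> \<one>" using x by simp
    then have "x \<in> P" unfolding P_def using subgroup.one_closed[OF D] by blast
    moreover have "y \<in> P" if "y \<in> F" for y
    proof -
      have "y \<in> D" using that by (simp add: D_def generate.incl)
      moreover have "y = x [^] (0::int) \<otimes> y" using that F by auto
      ultimately show ?thesis unfolding P_def by blast
    qed
    ultimately show ?thesis by blast
  qed
  ultimately have "generate G (insert x F) \<subseteq> P" by (metis generate_subgroup_incl)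
  \<comment> \<open>As \<open>x [^] k\<close> is trivial, exponents can be reduced modulo
    \<open>k\<close>, leaving finitely many products.\<close>
  moreover have "P \<subseteq> (\<lambda>(i, y). x [^] i \<otimes> y) ` ({0..<int k} \<times> D)"
  proof
    fix g assume "g \<in> P"
    then obtain i :: int and y where g: "g = x [^] i \<otimes> y" "y \<in> D" by (auto simp: P_def)
    have "x [^] i = x [^] (int k * (i div int k) + i mod int k)" by simp
    also have "\<dots> = x [^] (int k * (i div int k)) \<otimes> x [^] (i mod int k)"
      using x by (simp only: int_pow_mult)
    also have "x [^] (int k * (i div int k)) = (x [^] int k) [^] (i div int k)"
      using x by (simp add: int_pow_pow)
    also have "\<dots> = \<one>" using k by (simp add: int_pow_int)
    finally have "g = x [^] (i mod int k) \<otimes> y" using x g by simp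
    moreover have "i mod int k \<in> {0..<int k}" using k by simp
    ultimately show "g \<in> (\<lambda>(i, y). x [^] i \<otimes> y) ` ({0..<int k} \<times> D)" using g(2) by force
  qed
  ultimately show ?case using finD by (meson finite_SigmaI finite_atLeastLessThan_int finite_imageI finite_subset)
qed

lemma (in group) finite_rcosets_transversal:
  assumes "subgroup H G" "finite (rcosets H)"
  obtains T where "finite T" "T \<subseteq> carrier G" "\<And>g. g \<in> carrier G \<Longrightarrow> \<exists>h\<in>H. \<exists>t\<in>T. g = h \<otimes> t"
proof -
  define r where "r C = (SOME x. x \<in> carrier G \<and> H #> x = C)" for C
  have r: "r C \<in> carrier G \<and> H #> r C = C" if "C \<in> rcosets H" for C
    unfolding r_def by (rule someI_ex) (use that in \<open>auto simp: RCOSETS_def\<close>)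
  have "\<exists>h\<in>H. \<exists>t\<in>r ` (rcosets H). g = h \<otimes> t" if g: "g \<in> carrier G" for g
  proof -
    have C: "H #> g \<in> rcosets H" using g subgroup.subset[OF assms(1)] by (simp add: rcosetsI)
    have "g \<in> H #> g" using g assms(1) by (rule rcos_self)
    then have "g \<in> H #> r (H #> g)" using r[OF C] by simp
    then show ?thesis using C by (auto simp: r_coset_def)
  qed
  then show thesis using that[of "r ` (rcosets H)"] r assms(2) by blast
qed

lemma (in normal) finite_rcosets_of_comm_torsion_quotient:
  assumes "comm_group (G Mod H)" "finite S" "S \<subseteq> carrier G" "generate G S = carrier G"
    and "\<And>x. x \<in> carrier G \<Longrightarrow> \<exists>k::nat>0. x [^] k \<in> H"
  shows "finite (rcosets H)"
proof -
  interpret Q: comm_group "G Mod H" by fact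
  interpret p: group_hom G "G Mod H" "\<lambda>a. H #> a"
    by (rule group_hom.intro) (simp_all add: group_hom_axioms_def r_coset_hom_Mod is_group Q.is_group)
  have "generate (G Mod H) ((\<lambda>a. H #> a) ` S) = (\<lambda>a. H #> a) ` carrier G"
    using p.generate_img[OF assms(3)] assms(4) by simp
  also have "\<dots> = rcosets H" by (auto simp: RCOSETS_def)
  finally have gen: "rcosets H = generate (G Mod H) ((\<lambda>a. H #> a) ` S)" by simp
  show ?thesis unfolding gen
  proof (rule Q.finite_generate_torsion)
    show "finite ((\<lambda>a. H #> a) ` S)" using assms(2) by simp
    show "(\<lambda>a. H #> a) ` S \<subseteq> carrier (G Mod H)" using assms(3) by (auto simp: carrier_FactGroup)
    fix X assume "X \<in> (\<lambda>a. H #> a) ` S"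
    then obtain x where x: "X = H #> x" "x \<in> carrier G" using assms(3) by auto
    obtain k :: nat where "k > 0" "x [^] k \<in> H" using assms(5)[OF x(2)] by blast
    then show "\<exists>k::nat>0. X [^]\<^bsub>G Mod H\<^esub> k = \<one>\<^bsub>G Mod H\<^esub>"
      using FactGroup_pow[OF x(2)] x coset_join2 subgroup_axioms by auto
  qed
qed

text \<open>The abelianization is finite, so the derived subgroup has finite index and is finitely
  generated by Schreier's argument. The set \<open>T\<close> serves to lift finiteness back from the
  derived subgroup.\<close>

lemma (in group) derived_of_fg_torsion:
  assumes S: "finite S" "S \<subseteq> carrier G" "generate G S = carrier G"
    and tor: "\<And>x. x \<in> carrier G \<Longrightarrow> \<exists>k::nat>0. x [^] k = \<one>"
  obtains S' T where "finite S'" "S' \<subseteq> derived G (carrier G)" "generate G S' = derived G (carrier G)"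
    "finite T" "\<forall>g\<in>carrier G. \<exists>h\<in>derived G (carrier G). \<exists>t\<in>T. g = h \<otimes> t"
proof -
  interpret N: normal "derived G (carrier G)" G by (rule derived_self_is_normal)
  have "\<exists>k::nat>0. x [^] k \<in> derived G (carrier G)" if "x \<in> carrier G" for x
    using tor[OF that] N.one_closed by metis
  then have "finite (rcosets (derived G (carrier G)))"
    using N.finite_rcosets_of_comm_torsion_quotient[OF derived_quot_is_comm_group S] by blast
  then obtain T where T: "finite T" "T \<subseteq> carrier G"
      "\<And>g. g \<in> carrier G \<Longrightarrow> \<exists>h\<in>derived G (carrier G). \<exists>t\<in>T. g = h \<otimes> t"
    using finite_rcosets_transversal[OF N.subgroup_axioms] by metis
  obtain S' where "finite S'" "S' \<subseteq> derived G (carrier G)" "generate G S' = derived G (carrier G)"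
    using finite_index_subgroup_finitely_generated[OF S N.subgroup_axioms T] by metis
  with T that show thesis by metis
qed

text \<open>Induction on the derived length. Working with subgroups of a fixed group keeps the whole
  derived series in one ambient group.\<close>

lemma (in group) fg_torsion_solvable_finite_subgroup:
  assumes "subgroup H G" "finite S" "S \<subseteq> H" "generate G S = H"
    and "\<And>x. x \<in> H \<Longrightarrow> \<exists>k::nat>0. x [^] k = \<one>" and "(derived G ^^ n) H = {\<one>}"
  shows "finite H"
  using assms
proof (induction n arbitrary: H S)
  case 0
  then show ?case by simp
next
  case (Suc n)
  let ?GH = "G\<lparr>carrier := H\<rparr>"
  interpret H: group ?GH using Suc.prems(1) by (rule subgroup_imp_group)
  have d: "derived ?GH H = derived G H" by (rule derived_consistent[OF _ Suc.prems(1)]) simp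
  have sub: "derived G H \<subseteq> H" by (rule derived_incl[OF _ Suc.prems(1)]) simp
  have gen: "generate ?GH X = generate G X" if "X \<subseteq> H" for X
    by (rule generate_consistent[OF that Suc.prems(1)])
  have tor: "\<exists>k::nat>0. x [^]\<^bsub>?GH\<^esub> k = \<one>\<^bsub>?GH\<^esub>" if "x \<in> carrier ?GH" for x
    using Suc.prems(5)[of x] that by (simp add: nat_pow_consistent[symmetric])
  have S: "S \<subseteq> carrier ?GH" "generate ?GH S = carrier ?GH"
    using Suc.prems(3,4) gen[of S] by simp_all
  obtain S' T where ST: "finite S'" "S' \<subseteq> derived ?GH (carrier ?GH)"
      "generate ?GH S' = derived ?GH (carrier ?GH)" "finite T"
      "\<forall>g\<in>carrier ?GH. \<exists>h\<in>derived ?GH (carrier ?GH). \<exists>t\<in>T. g = h \<otimes>\<^bsub>?GH\<^esub> t"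
    by (rule H.derived_of_fg_torsion[OF Suc.prems(2) S tor])
  have S': "finite S'" "S' \<subseteq> derived G H" "generate ?GH S' = derived G H"
    using ST(1-3) d by simp_all
  have T: "finite T" "\<And>g. g \<in> H \<Longrightarrow> \<exists>h\<in>derived G H. \<exists>t\<in>T. g = h \<otimes> t"
    using ST(4,5) d by simp_all
  have "finite (derived G H)"
  proof (rule Suc.IH)
    show "subgroup (derived G H) G"
      by (rule derived_is_subgroup[OF subgroup.subset[OF Suc.prems(1)]])
    show "generate G S' = derived G H" using S' gen sub by auto
    show "\<exists>k::nat>0. x [^] k = \<one>" if "x \<in> derived G H" for x using that sub Suc.prems(5) by blast
    show "(derived G ^^ n) (derived G H) = {\<one>}"
      using Suc.prems(6) by (simp add: funpow_swap1)
  qed fact+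
  moreover have "H \<subseteq> (\<lambda>(h, t). h \<otimes> t) ` (derived G H \<times> T)" using T(2) by force
  ultimately show ?case using T(1) by (meson finite_SigmaI finite_imageI finite_subset)
qed

lemma (in normal) finite_rcosets_of_solvable_torsion_quotient:
  assumes "solvable G" "finite S" "S \<subseteq> carrier G" "generate G S = carrier G"
    and "\<And>x. x \<in> carrier G \<Longrightarrow> \<exists>k::nat>0. x [^] k \<in> H"
  shows "finite (rcosets H)"
proof -
  interpret Q: group "G Mod H" by (rule factorgroup_is_group)
  interpret p: group_hom G "G Mod H" "\<lambda>a. H #> a"
    by (rule group_hom.intro) (simp_all add: group_hom_axioms_def r_coset_hom_Mod is_group Q.is_group)
  have "solvable (G Mod H)"
    by (rule p.surj_hom_imp_solvable[OF _ assms(1)]) (simp add: carrier_FactGroup)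
  then obtain n where n: "(derived (G Mod H) ^^ n) (carrier (G Mod H)) = {\<one>\<^bsub>G Mod H\<^esub>}"
    using Q.solvable_iff_trivial_derived_seq by blast
  have "finite (carrier (G Mod H))"
  proof (rule Q.fg_torsion_solvable_finite_subgroup[OF Q.subgroup_self _ _ _ _ n])
    show "finite ((\<lambda>a. H #> a) ` S)" using assms(2) by simp
    show "(\<lambda>a. H #> a) ` S \<subseteq> carrier (G Mod H)" using assms(3) by (auto simp: carrier_FactGroup)
    show "generate (G Mod H) ((\<lambda>a. H #> a) ` S) = carrier (G Mod H)"
      using p.generate_img[OF assms(3)] assms(4) by (simp add: carrier_FactGroup)
    fix X assume "X \<in> carrier (G Mod H)"
    then obtain x where x: "X = H #> x" "x \<in> carrier G" by (auto simp: carrier_FactGroup)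
    obtain k :: nat where "k > 0" "x [^] k \<in> H" using assms(5)[OF x(2)] by blast
    then show "\<exists>k::nat>0. X [^]\<^bsub>G Mod H\<^esub> k = \<one>\<^bsub>G Mod H\<^esub>"
      using FactGroup_pow[OF x(2)] x coset_join2 subgroup_axioms by auto
  qed
  then show ?thesis by (simp add: FactGroup_def)
qed

section \<open>Two-generator subgroups isomorphic to Gc-groups\<close>

definition word_eval :: "('a, 'b) monoid_scheme \<Rightarrow> ('x \<Rightarrow> 'a) \<Rightarrow> 'x word \<Rightarrow> 'a" where
  "word_eval G g u = foldr (\<lambda>(x, e) y. (if e then g x else inv\<^bsub>G\<^esub> g x) \<otimes>\<^bsub>G\<^esub> y) u \<one>\<^bsub>G\<^esub>"

context group
begin

context
  fixes g :: "'x \<Rightarrow> 'a"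
  assumes g: "range g \<subseteq> carrier G"
begin

lemma g_closed [simp]: "g x \<in> carrier G"
  using g by auto

lemma word_eval_Nil [simp]: "word_eval G g [] = \<one>"
  by (simp add: word_eval_def)

lemma word_eval_Cons [simp]:
  "word_eval G g ((x, e) # u) = (if e then g x else inv (g x)) \<otimes> word_eval G g u"
  by (simp add: word_eval_def)

lemma word_eval_closed [simp]: "word_eval G g u \<in> carrier G"
  by (induction u) auto

lemma word_eval_append: "word_eval G g (u @ v) = word_eval G g u \<otimes> word_eval G g v"
  by (induction u) (auto simp: m_assoc)

lemma word_eval_free_equiv: "free_equiv u v \<Longrightarrow> word_eval G g u = word_eval G g v"
  by (induction rule: free_equiv.induct) (auto simp: word_eval_append mult_inv_mult)

lemma free_group_universal:
  obtains h where "h \<in> hom free_group G" "\<And>u. h (word_class u) = word_eval G g u"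
proof -
  \<comment> \<open>The chosen representative does not matter, because evaluation respects
    \<open>free_equiv\<close>.\<close>
  define h where "h A = word_eval G g (SOME u. A = word_class u)" for A
  have h: "h (word_class u) = word_eval G g u" for u
  proof -
    have "word_class u = word_class (SOME v. word_class u = word_class v)"
      by (rule someI) (rule HOL.refl)
    then have "free_equiv u (SOME v. word_class u = word_class v)"
      by (simp only: word_class_eq_iff)
    then show ?thesis unfolding h_def by (simp only: word_eval_free_equiv)
  qed
  have "h \<in> hom free_group G"
    by (auto simp: hom_def carrier_free_group h mult_word_class word_eval_append)
  then show thesis using h that by blast
qed

end

lemma hom_word_eval:
  fixes h :: "'x word set \<Rightarrow> 'a"
  assumes "h \<in> hom free_group G"
  shows "h (word_class u) = word_eval G (\<lambda>x. h (generator x)) u"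
proof -
  interpret F: group "free_group :: 'x word set monoid" by (rule group_free_group)
  interpret h: group_hom free_group G h
    by (rule group_hom.intro) (simp_all add: group_hom_axioms_def F.is_group is_group assms)
  have r: "range (\<lambda>x. h (generator x)) \<subseteq> carrier G" by (auto simp: generator_closed)
  show ?thesis
  proof (induction u)
    case Nil
    then show ?case using h.hom_one by (simp add: one_free_group word_eval_def)
  next
    case (Cons l u)
    obtain x e where l: "l = (x, e)" by (cases l)
    have inv: "word_class [(x, False)] = inv\<^bsub>free_group\<^esub> generator x"
    proof (rule F.inv_equality[symmetric])
      have "free_equiv ([] @ [(x, False), (x, \<not> False)] @ []) ([] @ [])" by (rule free_equiv.cancel)
      then show "word_class [(x, False)] \<otimes>\<^bsub>free_group\<^esub> generator x = \<one>\<^bsub>free_group\<^esub>"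
        by (simp add: generator_def mult_word_class one_free_group word_class_eq_iff)
    qed (auto simp: carrier_free_group generator_def)
    have "word_class (l # u) = word_class [l] \<otimes>\<^bsub>free_group\<^esub> word_class u"
      by (simp add: mult_word_class)
    then have "h (word_class (l # u)) = h (word_class [l]) \<otimes> h (word_class u)"
      by (simp add: carrier_free_group)
    moreover have "h (word_class [l]) = (if e then h (generator x) else inv (h (generator x)))"
      using inv by (simp add: l generator_def[symmetric] generator_closed)
    ultimately show ?case using Cons by (simp add: l word_eval_Cons[OF r])
  qed
qed

end

context commuting_conjugates
begin

text \<open>Appending letters one at a time on the right, \<open>normal_form_mult\<close> restores
  the form after each.\<close>

lemma word_eval_normal_form:
  fixes g :: "Gc_generator \<Rightarrow> 'a"
  assumes g: "g Alpha = a" "g Beta = b"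
  shows "\<exists>(m::int) p (k::nat). word_eval G g u = a [^] m \<otimes> E p \<otimes> inv (a [^] k)"
proof (induction u rule: rev_induct)
  case Nil
  show ?case
    by (rule exI[of _ 0], rule exI[of _ 0], rule exI[of _ 0]) (simp add: word_eval_def)
next
  case (snoc l u)
  obtain x e where l: "l = (x, e)" by (cases l)
  have r: "range g \<subseteq> carrier G"
  proof
    fix y assume "y \<in> range g"
    then obtain x where "y = g x" by blast
    then show "y \<in> carrier G" using g by (cases x) auto
  qed
  obtain m :: int and p and k :: nat where
    u: "word_eval G g u = a [^] m \<otimes> E p \<otimes> inv (a [^] k)"
    using snoc by blast
  have "word_eval G g (u @ [l]) = word_eval G g u \<otimes> (if e then g x else inv (g x))"
    using r by (simp add: l word_eval_append[OF r] word_eval_Cons[OF r] word_eval_Nil[OF r] range_subsetD)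
  note step = this and nf = normal_form_mult[of m p k]
  show ?case
  proof (cases x)
    case Alpha
    show ?thesis
    proof (cases e)
      case True
      show ?thesis by (simp only: step u Alpha True g if_True nf(1), (rule exI)+, rule HOL.refl)
    next
      case False
      show ?thesis by (simp only: step u Alpha False g if_False nf(2), (rule exI)+, rule HOL.refl)
    qed
  next
    case Beta
    show ?thesis
    proof (cases e)
      case True
      show ?thesis by (simp only: step u Beta True g if_True nf(3), (rule exI)+, rule HOL.refl)
    next
      case False
      show ?thesis by (simp only: step u Beta False g if_False nf(4), (rule exI)+, rule HOL.refl)
    qed
  qed
qed

end

text \<open>Matches the product in the defining relator with the Horner form. The offset
  \<open>k\<close> is what the induction on the list requires, since passing to the tail raises all
  exponents of \<open>a\<close> by one.\<close>

lemma (in two_elements) foldr_conj_eval: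
  "foldr (\<otimes>) (map (\<lambda>i. conjugate G b (a [^] (int (i + k))) [^] (xs ! i)) [0..<length xs]) \<one>
    = conjugate G (E (Poly xs)) (a [^] k)"
proof (induction xs arbitrary: k)
  case Nil
  then show ?case by simp
next
  case (Cons c xs)
  have upt: "[0..<length (c # xs)] = 0 # map Suc [0..<length xs]"
    by (simp add: map_Suc_upt upt_conv_Cons del: upt_Suc)
  have "foldr (\<otimes>) (map (\<lambda>i. conjugate G b (a [^] (int (i + k))) [^] ((c # xs) ! i)) [0..<length (c # xs)]) \<one>
     = conjugate G b (a [^] (int k)) [^] c \<otimes>
       foldr (\<otimes>) (map (\<lambda>i. conjugate G b (a [^] (int (i + Suc k))) [^] (xs ! i)) [0..<length xs]) \<one>"
    unfolding upt by (simp add: comp_def add.assoc)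
  also have "\<dots> = conjugate G b (a [^] (int k)) [^] c \<otimes> conjugate G (E (Poly xs)) (a [^] Suc k)"
    by (simp only: Cons.IH)
  also have "\<dots> = conjugate G b (a [^] k) [^] c \<otimes> conjugate G (E (Poly xs)) (a [^] Suc k)"
    by (simp only: int_pow_int)
  also have "\<dots> = conjugate G (b [^] c) (a [^] k) \<otimes> conjugate G (conjugate G (E (Poly xs)) a) (a [^] k)"
  proof -
    have "conjugate G (b [^] c) (a [^] k) = conjugate G b (a [^] k) [^] c"
    proof (cases c rule: int_cases2)
      case (nonneg n)
      then show ?thesis by (simp add: conjugate_nat_pow int_pow_int)
    next
      case (nonpos n)
      then show ?thesis by (simp add: conjugate_nat_pow conjugate_inv int_pow_neg int_pow_int)
    qed
    moreover have "conjugate G (E (Poly xs)) (a [^] Suc k)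
        = conjugate G (conjugate G (E (Poly xs)) a) (a [^] k)"
      using nat_pow_Suc2[OF a, of k] by (simp only: conjugate_conjugate E_closed a nat_pow_closed)
    ultimately show ?thesis by simp
  qed
  also have "\<dots> = conjugate G (E (Poly (c # xs))) (a [^] k)"
    by (simp add: E_pCons conjugate_mult)
  finally show ?case .
qed

section \<open>Roots, powers and commutators\<close>

lemma (in group) torsion_free_unique_root:
  assumes tf: "torsion_free_group G" and xy: "x \<in> carrier G" "y \<in> carrier G" "x \<otimes> y = y \<otimes> x"
    and n: "n > 0" "x [^] (n::nat) = y [^] n"
  shows "x = y"
proof -
  have "(x \<otimes> inv y) [^] n = x [^] n \<otimes> inv y [^] n"
    using xy by (intro pow_mult_distrib commute_inv) auto
  also have "\<dots> = \<one>" using xy n by (simp add: nat_pow_inv)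
  finally have "x \<otimes> inv y = \<one>"
    using tf n xy unfolding torsion_free_group_def by blast
  then show ?thesis using xy by (metis inv_equality inv_inv inv_closed)
qed

text \<open>Both \<open>x\<close> and its conjugate by \<open>y\<close> are \<open>n\<close>-th
  roots of the same element, and they commute, so they coincide.\<close>

lemma (in group) torsion_free_commute_pow:
  assumes tf: "torsion_free_group G" and xy: "x \<in> carrier G" "y \<in> carrier G"
    and c: "x \<otimes> conjugate G x y = conjugate G x y \<otimes> x"
    and n: "n > 0" "x [^] (n::nat) \<otimes> y = y \<otimes> x [^] n"
  shows "x \<otimes> y = y \<otimes> x"
proof -
  have "conjugate G x y [^] n = x [^] n"
    using n(2) xy conjugate_eq_iff[of "x [^] n" y] by (simp add: conjugate_nat_pow)
  then have "conjugate G x y = x"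
    using torsion_free_unique_root[OF tf _ xy(1) c[symmetric] n(1)] xy by simp
  then show ?thesis using xy by (simp add: conjugate_eq_iff)
qed

text \<open>Pigeonhole: two distinct powers of \<open>x\<close> share a coset.\<close>

lemma (in group) finite_index_pow_mem:
  assumes H: "subgroup H G" "finite (rcosets H)" and x: "x \<in> carrier G"
  shows "\<exists>k::nat>0. x [^] k \<in> H"
proof -
  have sub: "H \<subseteq> carrier G" using H(1) by (rule subgroup.subset)
  have "range (\<lambda>n::nat. H #> x [^] n) \<subseteq> rcosets H" using sub x by (auto simp: rcosetsI)
  then have "\<not> inj (\<lambda>n::nat. H #> x [^] n)"
    using H(2) by (meson finite_imageD finite_subset infinite_UNIV_nat)
  then obtain i j :: nat where ij: "i < j" "H #> x [^] i = H #> x [^] j"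
    unfolding inj_def by (metis nat_neq_iff)
  have "x [^] j \<in> H #> x [^] i" unfolding ij(2) using x H(1) by (intro rcos_self) auto
  then obtain h where h: "h \<in> H" "x [^] j = h \<otimes> x [^] i" by (auto simp: r_coset_def)
  have "x [^] (j - i) \<otimes> x [^] i = h \<otimes> x [^] i" using ij(1) x h(2) by (simp add: nat_pow_mult)
  then have "x [^] (j - i) = h" using x h(1) sub by (simp add: right_cancel subsetD)
  with h(1) ij(1) show ?thesis by (intro exI[of _ "j - i"]) simp
qed

lemma (in group) commutator_eq_one_iff:
  assumes "x \<in> carrier G" "y \<in> carrier G"
  shows "commutator G x y = \<one> \<longleftrightarrow> x \<otimes> y = y \<otimes> x"
proof -
  have "commutator G x y = inv (y \<otimes> x) \<otimes> (x \<otimes> y)"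
    using assms by (simp add: commutator_def m_assoc inv_mult_group)
  also have "\<dots> = \<one> \<longleftrightarrow> x \<otimes> y = y \<otimes> x"
    using assms by (simp add: inv_solve_left')
  finally show ?thesis .
qed

lemma (in group_hom) hom_commutator:
  "x \<in> carrier G \<Longrightarrow> y \<in> carrier G \<Longrightarrow> h (commutator G x y) = commutator H (h x) (h y)"
  by (simp add: commutator_def)

lemma Gc_tuple_coeffs:
  assumes "content f = 1" "coeff f 0 \<noteq> 0" "degree f > 0"
  shows "Gc_tuple (coeffs f)"
proof -
  have f: "f \<noteq> 0" using assms(2) by auto
  then have "hd (coeffs f) = coeff f 0" by (simp add: hd_conv_nth coeffs_nth)
  moreover have "Gcd (set (coeffs f)) = 1" using assms(1) by (simp add: content_def)
  ultimately show ?thesis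
    using assms f by (simp add: Gc_tuple_def length_coeffs_degree last_coeffs_eq_coeff_degree)
qed

lemma foldr_beta_conj:
  "foldr (\<otimes>\<^bsub>free_group\<^esub>)
      (map (\<lambda>i. beta_conj (int i) [^]\<^bsub>free_group\<^esub> (coeffs f ! i)) [0..<length (coeffs f)]) \<one>\<^bsub>free_group\<^esub>
    = conj_eval free_group (generator Alpha) (generator Beta) f"
proof -
  interpret F: group "free_group :: Gc_generator word set monoid" by (rule group_free_group)
  interpret F: two_elements free_group "generator Alpha" "generator Beta"
    by unfold_locales (simp_all add: generator_closed)
  show ?thesis using F.foldr_conj_eval[of 0 "coeffs f"] by (simp add: beta_conj_def)
qed

context commuting_conjugates
begin

text \<open>The equation makes \<open>E p\<close> a power of \<open>a\<close>. As a member of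
  \<open>B\<close> it commutes with \<open>b\<close>, so \<open>nc\<close> forces its exponent to be
  zero.\<close>

lemma normal_form_eq_one:
  fixes m :: int and k :: nat
  assumes nc: "\<And>k::nat. k > 0 \<Longrightarrow> b \<otimes> a [^] k \<noteq> a [^] k \<otimes> b"
    and one: "a [^] m \<otimes> E p \<otimes> inv (a [^] k) = \<one>"
  shows "m = int k" "E p = \<one>"
proof -
  have "a [^] m \<otimes> E p = a [^] k"
    using one by (metis E_closed a inv_equality inv_inv inv_closed int_pow_closed m_closed nat_pow_closed)
  then have "E p = inv (a [^] m) \<otimes> a [^] k" using mult_inv_mult(2)[of "a [^] m" "E p"] by simp
  moreover have "a [^] (- m + int k) = inv (a [^] m) \<otimes> a [^] k"
    by (simp only: int_pow_mult int_pow_neg int_pow_int a)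
  ultimately have Ep: "E p = a [^] (- m + int k)" by simp
  have c: "b \<otimes> a [^] (- m + int k) = a [^] (- m + int k) \<otimes> b"
    using B_commute[OF b_in_B E_in_B[of p]] unfolding Ep .
  show m: "m = int k"
  proof (rule ccontr)
    assume ne: "m \<noteq> int k"
    define d where "d = nat \<bar>- m + int k\<bar>"
    have "b \<otimes> a [^] d = a [^] d \<otimes> b"
    proof (cases "- m + int k \<ge> 0")
      case True
      then have "a [^] d = a [^] (- m + int k)" by (simp add: d_def flip: int_pow_int)
      with c show ?thesis by simp
    next
      case False
      then have "int d = - (- m + int k)" by (simp add: d_def)
      then have "a [^] int d = inv (a [^] (- m + int k))" by (simp only: int_pow_neg a)
      then have "a [^] d = inv (a [^] (- m + int k))" by (simp only: int_pow_int)
      with commute_inv[OF b _ c] show ?thesis by simp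
    qed
    moreover have "d > 0" using ne by (simp add: d_def)
    ultimately show False using nc by blast
  qed
  show "E p = \<one>" unfolding Ep m by simp
qed

text \<open>The map from the free group onto the subgroup generated by \<open>a\<close> and
  \<open>b\<close> has the normal closure of the relators as its kernel: modulo the relators every
  word has a normal form, and if its image is trivial then its polynomial is a multiple of
  \<open>f\<close>, which the relators already kill.\<close>

lemma proper_Gc_subgroup:
  assumes tf: "torsion_free_group G"
    and nc: "\<And>k::nat. k > 0 \<Longrightarrow> b \<otimes> a [^] k \<noteq> a [^] k \<otimes> b"
    and f: "content f = 1" "coeff f 0 \<noteq> 0" "\<And>p. E p = \<one> \<longleftrightarrow> f dvd p"
  obtains H where "subgroup H G" "proper_Gc_group (G\<lparr>carrier := H\<rparr>)"
proof -
  let ?F = "free_group :: Gc_generator word set monoid"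
  let ?A = "generator Alpha" and ?B = "generator Beta"
  define c where "c = coeffs f"
  define N where "N = normal_closure ?F (Gc_relators c)"
  interpret F: group ?F by (rule group_free_group)
  interpret F2: two_elements ?F ?A ?B by unfold_locales (simp_all add: generator_closed)
  interpret N: normal N ?F
    unfolding N_def by (rule F.normal_closure_normal[OF Gc_relators_closed])
  interpret Q: group "?F Mod N" by (rule N.factorgroup_is_group)
  define \<pi> where "\<pi> x = N #>\<^bsub>?F\<^esub> x" for x
  interpret p: group_hom ?F "?F Mod N" \<pi>
    using N.r_coset_hom_Mod by (auto simp: group_hom_def group_hom_axioms_def F.is_group Q.is_group \<pi>_def[abs_def])
  have \<pi>_one: "\<pi> x = N \<longleftrightarrow> x \<in> N" if "x \<in> carrier ?F" for x
    using that F.coset_join1[OF _ that N.subgroup_axioms] F.coset_join2[OF that N.subgroup_axioms] N.subset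
    by (auto simp: \<pi>_def)
  define g where "g x = (case x of Alpha \<Rightarrow> a | Beta \<Rightarrow> b)" for x
  have g: "range g \<subseteq> carrier G" by (auto simp: g_def split: Gc_generator.split)
  obtain \<phi> where \<phi>: "\<phi> \<in> hom ?F G" and \<phi>u: "\<And>u. \<phi> (word_class u) = word_eval G g u"
    using free_group_universal[OF g] by blast
  interpret f: group_hom ?F G \<phi>
    by (auto simp: group_hom_def group_hom_axioms_def F.is_group is_group \<phi>)
  have \<phi>A: "\<phi> ?A = a" and \<phi>B: "\<phi> ?B = b"
    unfolding generator_def \<phi>u by (simp_all add: word_eval_def g_def)
  have bc: "beta_conj i \<in> carrier ?F" for i
    by (simp add: beta_conj_def)
  have relN: "r \<in> N" if "r \<in> Gc_relators c" for r
  proof -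
    have "r \<in> carrier ?F" using Gc_relators_closed that by blast
    then have "r = conjugate ?F r \<one>\<^bsub>?F\<^esub>" by simp
    then show ?thesis
      unfolding N_def normal_closure_def using that by (auto intro!: generate.incl)
  qed
  \<comment> \<open>The commutator relators make the quotient an instance of the locale, so normal
    forms are available there before anything is known about the kernel.\<close>
  interpret Q: commuting_conjugates "?F Mod N" "\<pi> ?A" "\<pi> ?B"
  proof unfold_locales
    fix i :: int
    have "commutator ?F ?B (beta_conj i) \<in> N" by (rule relN) (simp add: Gc_relators_def)
    moreover have "commutator ?F ?B (beta_conj i) \<in> carrier ?F" using calculation N.subset by blast
    ultimately have "\<pi> (commutator ?F ?B (beta_conj i)) = \<one>\<^bsub>?F Mod N\<^esub>" by (simp add: \<pi>_one)
    then have "commutator (?F Mod N) (\<pi> ?B) (\<pi> (beta_conj i)) = \<one>\<^bsub>?F Mod N\<^esub>"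
      using p.hom_commutator[of ?B "beta_conj i"] bc by simp
    moreover have "\<pi> (beta_conj i) = conjugate (?F Mod N) (\<pi> ?B) (\<pi> ?A [^]\<^bsub>?F Mod N\<^esub> i)"
      unfolding beta_conj_def by (simp add: p.hom_conjugate p.hom_int_pow)
    ultimately show "\<pi> ?B \<otimes>\<^bsub>?F Mod N\<^esub> conjugate (?F Mod N) (\<pi> ?B) (\<pi> ?A [^]\<^bsub>?F Mod N\<^esub> i)
        = conjugate (?F Mod N) (\<pi> ?B) (\<pi> ?A [^]\<^bsub>?F Mod N\<^esub> i) \<otimes>\<^bsub>?F Mod N\<^esub> \<pi> ?B"
      using Q.commutator_eq_one_iff[of "\<pi> ?B" "\<pi> (beta_conj i)"] bc by simp
  qed simp_all
  have "conj_eval ?F ?A ?B f \<in> N"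
    unfolding foldr_beta_conj[symmetric] by (rule relN) (simp add: Gc_relators_def c_def)
  then have QE: "Q.E f = \<one>\<^bsub>?F Mod N\<^esub>"
    using p.hom_conj_eval[of ?A ?B f] \<pi>_one[of "conj_eval ?F ?A ?B f"] by simp
  have ker: "kernel ?F G \<phi> = N"
  proof
    have "r \<in> kernel ?F G \<phi>" if "r \<in> Gc_relators c" for r
    proof -
      have rc: "r \<in> carrier ?F" using Gc_relators_closed that by blast
      have "\<phi> r = \<one>"
        using that unfolding Gc_relators_def
      proof
        assume "r \<in> range (\<lambda>i::int. commutator ?F ?B (beta_conj i))"
        then obtain i :: int where r: "r = commutator ?F ?B (beta_conj i)" by blast
        have "\<phi> (beta_conj i) = conjugate G b (a [^] i)"
          unfolding beta_conj_def by (simp add: f.hom_conjugate f.hom_int_pow \<phi>A \<phi>B)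
        then have "\<phi> r = commutator G b (conjugate G b (a [^] i))"
          unfolding r using f.hom_commutator[of ?B "beta_conj i"] bc by (simp add: \<phi>B)
        also have "\<dots> = \<one>" using commute[of i] by (simp add: commutator_eq_one_iff)
        finally show ?thesis .
      next
        assume "r \<in> {foldr (\<otimes>\<^bsub>?F\<^esub>) (map (\<lambda>i. beta_conj (int i) [^]\<^bsub>?F\<^esub> (c ! i)) [0..<length c]) \<one>\<^bsub>?F\<^esub>}"
        then have "r = conj_eval ?F ?A ?B f" by (simp add: c_def foldr_beta_conj)
        then show ?thesis
          using f.hom_conj_eval[of ?A ?B f] f(3)[of f] by (simp add: \<phi>A \<phi>B)
      qed
      with rc show ?thesis by (simp add: kernel_def)
    qed
    then have "{conjugate ?F r x |r x. r \<in> Gc_relators c \<and> x \<in> carrier ?F} \<subseteq> kernel ?F G \<phi>"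
      by (auto simp: kernel_def f.hom_conjugate)
    then show "N \<subseteq> kernel ?F G \<phi>"
      unfolding N_def normal_closure_def
      by (rule F.generate_subgroup_incl[OF _ f.subgroup_kernel])
    show "kernel ?F G \<phi> \<subseteq> N"
    proof
      fix w assume w: "w \<in> kernel ?F G \<phi>"
      then have wc: "w \<in> carrier ?F" and w1: "\<phi> w = \<one>" by (auto simp: kernel_def)
      obtain u where u: "w = word_class u" using wc by (auto simp: carrier_free_group)
      obtain m :: int and q and k :: nat where
        "word_eval (?F Mod N) (\<lambda>x. \<pi> (generator x)) u
          = \<pi> ?A [^]\<^bsub>?F Mod N\<^esub> m \<otimes>\<^bsub>?F Mod N\<^esub> Q.E q \<otimes>\<^bsub>?F Mod N\<^esub> inv\<^bsub>?F Mod N\<^esub> (\<pi> ?A [^]\<^bsub>?F Mod N\<^esub> k)"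
        using Q.word_eval_normal_form[of "\<lambda>x. \<pi> (generator x)"] by blast
      then have \<pi>w: "\<pi> w = \<pi> ?A [^]\<^bsub>?F Mod N\<^esub> m \<otimes>\<^bsub>?F Mod N\<^esub> Q.E q \<otimes>\<^bsub>?F Mod N\<^esub> inv\<^bsub>?F Mod N\<^esub> (\<pi> ?A [^]\<^bsub>?F Mod N\<^esub> k)"
        unfolding u Q.hom_word_eval[OF p.homh] .
      \<comment> \<open>Lifting the normal form to the free group gives an element differing from
        \<open>w\<close> by a member of \<open>N\<close>, so \<open>\<phi>\<close> sees the same
        \<open>m\<close>, \<open>q\<close> and \<open>k\<close>.\<close>
      define x where "x = ?A [^]\<^bsub>?F\<^esub> m \<otimes>\<^bsub>?F\<^esub> F2.E q \<otimes>\<^bsub>?F\<^esub> inv\<^bsub>?F\<^esub> (?A [^]\<^bsub>?F\<^esub> k)"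
      have xc: "x \<in> carrier ?F" by (simp add: x_def)
      have "\<pi> w = \<pi> x"
        unfolding \<pi>w x_def by (simp add: p.hom_conj_eval p.hom_int_pow p.hom_nat_pow)
      moreover have "w \<in> \<pi> w" unfolding \<pi>_def by (rule F.rcos_self[OF wc N.subgroup_axioms])
      ultimately obtain n where n: "n \<in> N" "w = n \<otimes>\<^bsub>?F\<^esub> x" by (auto simp: \<pi>_def r_coset_def)
      then have "\<phi> w = \<phi> x"
        using \<open>N \<subseteq> kernel ?F G \<phi>\<close> xc by (auto simp: kernel_def subset_iff)
      then have "a [^] m \<otimes> E q \<otimes> inv (a [^] k) = \<one>"
        using w1 by (simp add: x_def f.hom_conj_eval f.hom_int_pow f.hom_nat_pow \<phi>A \<phi>B)
      then have m: "m = int k" and "E q = \<one>" using normal_form_eq_one[OF nc] by blast+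
      then obtain s where "q = f * s" using f(3) by (auto elim: dvdE)
      then have "Q.E q = \<one>\<^bsub>?F Mod N\<^esub>" using Q.E_mult_eq_one[OF QE, of s] by (simp add: mult.commute)
      \<comment> \<open>With \<open>m = int k\<close> and a trivial middle factor, the two powers of
        \<open>a\<close> cancel.\<close>
      then have "\<pi> w = \<one>\<^bsub>?F Mod N\<^esub>" unfolding \<pi>w m by (simp add: int_pow_int del: one_FactGroup mult_FactGroup)
      then show "w \<in> N" using wc by (simp add: \<pi>_one)
    qed
  qed
  define H where "H = \<phi> ` carrier ?F"
  let ?K = "G\<lparr>carrier := H\<rparr>"
  have H: "subgroup H G" unfolding H_def by (rule f.img_is_subgroup)
  interpret K: group ?K using H by (rule subgroup_imp_group)
  have "\<phi> \<in> hom ?F ?K" using \<phi> by (auto simp: hom_def H_def)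
  then interpret k: group_hom ?F ?K \<phi>
    by (simp add: group_hom_def group_hom_axioms_def F.is_group K.is_group)
  have "kernel ?F ?K \<phi> = N" using ker by (simp add: kernel_def)
  then have "Gc c \<cong> ?K"
    using k.FactGroup_iso by (simp add: H_def Gc_def presented_group_def N_def)
  then have iso: "?K \<cong> Gc c" by (rule group.iso_sym[OF group_Gc])
  \<comment> \<open>A constant polynomial of content one is a unit, so \<open>b\<close> would be
    trivial and commute with \<open>a\<close>.\<close>
  have "degree f \<noteq> 0"
  proof
    assume "degree f = 0"
    then obtain d where d: "f = [:d:]" by (rule degree_eq_zeroE)
    with f(1) have "f dvd [:1:]" by (simp add: const_poly_dvd_const_poly_iff)
    then have "E [:1:] = \<one>" using f(3) by blast
    then have "b = \<one>" by (simp add: E_pCons)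
    with nc[of 1] show False by simp
  qed
  then have "Gc_group ?K"
    unfolding Gc_group_def using iso Gc_tuple_coeffs[OF f(1,2)] K.is_group by (auto simp: c_def)
  moreover have "\<not> virtually_abelian ?K"
  proof
    assume "virtually_abelian ?K"
    then obtain L where L: "subgroup L ?K" "finite (rcosets\<^bsub>?K\<^esub> L)" "comm_group (?K\<lparr>carrier := L\<rparr>)"
      unfolding virtually_abelian_def by blast
    have "\<phi> ?A \<in> H" "\<phi> ?B \<in> H" unfolding H_def by (simp_all add: generator_closed)
    then have "a \<in> H" "b \<in> H" by (simp_all add: \<phi>A \<phi>B)
    have "\<exists>k::nat>0. x [^] k \<in> L" if "x \<in> H" for x
      using K.finite_index_pow_mem[OF L(1,2), of x] that by (simp add: nat_pow_consistent[symmetric])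
    \<comment> \<open>Powers of \<open>a\<close> and \<open>b\<close> in an abelian subgroup of
      finite index commute; uniqueness of roots then makes \<open>b\<close> itself commute with
      \<open>a [^] m\<close>.\<close>
    then obtain m n :: nat where mn: "m > 0" "a [^] m \<in> L" "n > 0" "b [^] n \<in> L"
      using \<open>a \<in> H\<close> \<open>b \<in> H\<close> by meson
    have "b [^] n \<otimes> a [^] m = a [^] m \<otimes> b [^] n"
      using comm_groupE(4)[OF L(3)] mn by simp
    then have "b \<otimes> a [^] m = a [^] m \<otimes> b"
      by (rule torsion_free_commute_pow[OF tf b nat_pow_closed[OF a] commute[of "int m", unfolded int_pow_int] mn(3)])
    with nc mn(1) show False by blast
  qed
  ultimately show thesis using that[OF H] by (simp add: proper_Gc_group_def)
qed

end

section \<open>Powers commuting with an element\<close>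

context commuting_conjugates
begin

text \<open>Multiplication by \<open>x - 1\<close> turns \<open>E p\<close> into the commutator of
  \<open>inv a\<close> and \<open>E p\<close>.\<close>

lemma E_times_X_minus_1_in_derived: "E (p * [:-1, 1:]) \<in> derived G (carrier G)"
proof -
  have "E (p * [:-1, 1:]) = E (pCons 0 p - p)" by simp
  also have "\<dots> = inv a \<otimes> E p \<otimes> inv (inv a) \<otimes> inv (E p)"
    by (simp only: E_diff E_shift conjugate_def inv_inv a)
  also have "\<dots> \<in> derived G (carrier G)"
    unfolding derived_def by (rule generate.incl) (use E_closed[of p] inv_closed[OF a] in blast)
  finally show ?thesis .
qed

text \<open>The values of multiples of \<open>x - 1\<close> form a subgroup of finite rank,
  witnessed by polynomials of bounded degree. A multiple of larger degree then depends on these,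
  which is a nontrivial relation.\<close>

lemma exists_relation_or_Z_infinity:
  assumes no: "\<And>H. subgroup H G \<Longrightarrow> H \<subseteq> derived G (carrier G) \<Longrightarrow> \<not> G\<lparr>carrier := H\<rparr> \<cong> Z_infinity"
  obtains p where "p \<noteq> 0" "E p = \<one>"
proof -
  let ?d = "[:-1, 1:] :: int poly"
  have subgroup: "subgroup ((\<lambda>p. E (p * ?d)) ` P) G"
    if "0 \<in> P" "\<And>p q. p \<in> P \<Longrightarrow> q \<in> P \<Longrightarrow> p - q \<in> P" for P
  proof (rule subgroupI)
    show "(\<lambda>p. E (p * ?d)) ` P \<subseteq> carrier G" by auto
    show "(\<lambda>p. E (p * ?d)) ` P \<noteq> {}" using that(1) by blast
    fix x assume "x \<in> (\<lambda>p. E (p * ?d)) ` P"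
    then obtain p where p: "p \<in> P" "x = E (p * ?d)" by blast
    have "inv x = E ((0 - p) * ?d)"
      unfolding p(2) E_minus[symmetric] by (simp only: diff_0 mult_minus_left)
    then show "inv x \<in> (\<lambda>p. E (p * ?d)) ` P" using that(2)[OF that(1) p(1)] by blast
    fix y assume "y \<in> (\<lambda>p. E (p * ?d)) ` P"
    then obtain q where q: "q \<in> P" "y = E (q * ?d)" by blast
    have "x \<otimes> y = E ((p - (0 - q)) * ?d)"
      unfolding p(2) q(2) E_add[symmetric] by (simp only: ring_distribs diff_0 diff_minus_eq_add)
    moreover have "p - (0 - q) \<in> P" using that(2)[OF p(1) that(2)[OF that(1) q(1)]] .
    ultimately show "x \<otimes> y \<in> (\<lambda>p. E (p * ?d)) ` P" by blast
  qed
  define A where "A = range (\<lambda>p. E (p * ?d))"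
  have A: "subgroup A G" unfolding A_def by (rule subgroup) auto
  have comm: "x \<otimes> y = y \<otimes> x" if "x \<in> A" "y \<in> A" for x y
    using that unfolding A_def by (auto intro!: B_commute)
  have "A \<subseteq> derived G (carrier G)" unfolding A_def using E_times_X_minus_1_in_derived by blast
  then have noA: "\<not> G\<lparr>carrier := H\<rparr> \<cong> Z_infinity" if "subgroup H G" "H \<subseteq> A" for H
    using no that by blast
  obtain X where X: "finite X" "X \<subseteq> A" "\<forall>x\<in>A. \<exists>k::nat>0. x [^] k \<in> generate G X"
    using finite_rank_or_Z_infinity[OF A comm noA] .
  obtain r where r: "x = E (r x * ?d)" if "x \<in> X" for x
  proof -
    have "\<forall>x\<in>X. \<exists>p. x = E (p * ?d)" using X(2) by (auto simp: A_def)
    from bchoice[OF this] show thesis using that by blast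
  qed
  \<comment> \<open>The inserted \<open>0\<close> covers an empty \<open>X\<close>.\<close>
  define n where "n = Max (insert 0 ((\<lambda>x. degree (r x)) ` X))"
  define P where "P = {p :: int poly. degree p \<le> n}"
  have gen: "generate G X \<subseteq> (\<lambda>p. E (p * ?d)) ` P"
  proof (rule generate_subgroup_incl)
    show "subgroup ((\<lambda>p. E (p * ?d)) ` P) G"
      by (rule subgroup) (auto simp: P_def intro: degree_diff_le)
    show "X \<subseteq> (\<lambda>p. E (p * ?d)) ` P"
    proof
      fix x assume x: "x \<in> X"
      then have "degree (r x) \<le> n" unfolding n_def using X(1) by (intro Max_ge) auto
      then show "x \<in> (\<lambda>p. E (p * ?d)) ` P" using r[OF x] unfolding P_def by blast
    qed
  qed
  \<comment> \<open>One degree above the bound, so the coefficient \<open>k\<close> of this monomial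
    survives subtraction of \<open>q\<close> and the relation is nonzero.\<close>
  let ?x = "monom 1 (Suc n) :: int poly"
  obtain k :: nat where k: "k > 0" "E (?x * ?d) [^] k \<in> generate G X"
    using bspec[OF X(3), of "E (?x * ?d)"] unfolding A_def by blast
  then obtain q where q: "degree q \<le> n" "E (?x * ?d) [^] k = E (q * ?d)"
    using gen unfolding P_def by blast
  define p where "p = (smult (int k) ?x - q) * ?d"
  have "coeff (smult (int k) ?x - q) (Suc n) \<noteq> 0"
    using q(1) k(1) by (simp add: coeff_eq_0)
  then have "smult (int k) ?x - q \<noteq> 0" by auto
  then have "p \<noteq> 0" unfolding p_def by (intro no_zero_divisors) simp_all
  moreover have "E p = \<one>"
  proof -
    have "p = smult (int k) (?x * ?d) - q * ?d" unfolding p_def by (simp only: left_diff_distrib mult_smult_left)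
    then have "E p = E (?x * ?d) [^] int k \<otimes> inv (E (q * ?d))"
      by (simp only: E_diff E_smult)
    then show ?thesis by (simp only: int_pow_int q(2) r_inv E_closed)
  qed
  ultimately show thesis using that by blast
qed

text \<open>Otherwise the kernel of \<open>E\<close> is a nonzero saturated ideal, hence principal
  with primitive generator, and its generator yields a proper Gc-subgroup.\<close>

lemma power_commutes:
  assumes tf: "torsion_free_group G"
    and noZ: "\<And>H. subgroup H G \<Longrightarrow> H \<subseteq> derived G (carrier G) \<Longrightarrow> \<not> G\<lparr>carrier := H\<rparr> \<cong> Z_infinity"
    and noGc: "\<And>H. subgroup H G \<Longrightarrow> \<not> proper_Gc_group (G\<lparr>carrier := H\<rparr>)"
  shows "\<exists>k::nat>0. b \<otimes> a [^] k = a [^] k \<otimes> b"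
proof (rule ccontr)
  assume nc: "\<not> ?thesis"
  obtain p\<^sub>0 where p0: "p\<^sub>0 \<noteq> 0" "E p\<^sub>0 = \<one>" using exists_relation_or_Z_infinity[OF noZ] .
  have sat: "E p = \<one>" if "E (smult n p) = \<one>" "n \<noteq> 0" for n p
  proof -
    have "E (smult (int (nat \<bar>n\<bar>)) p) = \<one>"
      using that(1) E_minus[of "smult n p"] by (cases "n \<ge> 0") auto
    then have "E p [^] nat \<bar>n\<bar> = \<one>" by (simp only: E_smult int_pow_int)
    then show ?thesis using tf that(2) E_closed[of p] unfolding torsion_free_group_def
      by (metis zero_less_abs_iff zero_less_nat_eq)
  qed
  obtain f where f: "content f = 1" "coeff f 0 \<noteq> 0" "\<And>p. p \<in> {p. E p = \<one>} \<longleftrightarrow> f dvd p"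
    by (rule saturated_int_poly_ideal_principal[of "{p. E p = \<one>}" p\<^sub>0])
      (use p0 sat in \<open>auto simp: E_add E_mult_eq_one E_shift conjugate_eq_one_iff\<close>)
  have nc': "b \<otimes> a [^] k \<noteq> a [^] k \<otimes> b" if "k > 0" for k :: nat
    using nc that by blast
  have f3: "E p = \<one> \<longleftrightarrow> f dvd p" for p using f(3)[of p] by simp
  show False by (rule proper_Gc_subgroup[OF tf nc' f(1,2) f3]) (use noGc in blast)+
qed

end

section \<open>Centralizers and commuting powers\<close>

lemma (in group) commuting_conjugatesI:
  assumes "a \<in> carrier G" "b \<in> carrier G"
    and "\<And>i::int. b \<otimes> conjugate G b (a [^] i) = conjugate G b (a [^] i) \<otimes> b"
  shows "commuting_conjugates G a b"
  using assms by unfold_locales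

lemma (in group) centralizer_normal:
  assumes A: "A \<lhd> G"
  shows "{c \<in> carrier G. \<forall>x\<in>A. c \<otimes> x = x \<otimes> c} \<lhd> G"
proof -
  interpret A: normal A G by fact
  let ?C = "{c \<in> carrier G. \<forall>x\<in>A. c \<otimes> x = x \<otimes> c}"
  have C: "subgroup ?C G"
  proof (rule subgroupI)
    show "?C \<noteq> {}" by (auto intro!: exI[of _ \<one>])
    fix c assume "c \<in> ?C"
    then show "inv c \<in> ?C" using commute_inv[of _ c] by (auto simp: eq_commute)
    fix d assume "d \<in> ?C"
    with \<open>c \<in> ?C\<close> show "c \<otimes> d \<in> ?C" using commute_mult[of _ c d] by (auto simp: eq_commute)
  qed auto
  show ?thesis
  proof (rule normal_invI[OF C])
    fix g c assume g: "g \<in> carrier G" and c: "c \<in> ?C"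
    have "(g \<otimes> c \<otimes> inv g) \<otimes> x = x \<otimes> (g \<otimes> c \<otimes> inv g)" if x: "x \<in> A" for x
    proof -
      define y where "y = inv g \<otimes> x \<otimes> g"
      have y: "y \<in> A" unfolding y_def using A.inv_op_closed1[OF g x] .
      have xg: "x = g \<otimes> y \<otimes> inv g" using g x by (simp add: y_def m_assoc mult_inv_mult)
      have "c \<otimes> y = y \<otimes> c" using c y by blast
      then show ?thesis
        unfolding xg using g c A.mem_carrier[OF y] by (simp add: m_assoc mult_inv_mult) (simp flip: m_assoc)
    qed
    moreover have "g \<otimes> c \<otimes> inv g \<in> carrier G" using g c by simp
    ultimately show "g \<otimes> c \<otimes> inv g \<in> ?C" by blast
  qed
qed

lemma (in group) derived_series_normal: "(derived G ^^ n) (carrier G) \<lhd> G"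
  by (induction n) (simp_all add: normal_self derived_is_normal)

lemma (in group) normal_conjugate: "N \<lhd> G \<Longrightarrow> x \<in> N \<Longrightarrow> g \<in> carrier G \<Longrightarrow> conjugate G x g \<in> N"
  unfolding conjugate_def by (rule normal.inv_op_closed1)

text \<open>The product of the individual exponents serves all elements at once.\<close>

lemma (in group) common_commuting_power:
  assumes "finite X" "X \<subseteq> carrier G" "g \<in> carrier G"
    and "\<And>x. x \<in> X \<Longrightarrow> \<exists>k::nat>0. x \<otimes> g [^] k = g [^] k \<otimes> x"
  shows "\<exists>k::nat>0. \<forall>x\<in>X. x \<otimes> g [^] k = g [^] k \<otimes> x"
  using assms
proof (induction X rule: finite_induct)
  case empty
  then show ?case by auto
next
  case (insert x F)
  have pow: "y \<otimes> g [^] (i * j) = g [^] (i * j) \<otimes> y"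
    if "y \<in> carrier G" "y \<otimes> g [^] i = g [^] i \<otimes> y" for y and i j :: nat
  proof -
    have "y \<otimes> (g [^] i) [^] j = (g [^] i) [^] j \<otimes> y"
    proof (induction j)
      case (Suc j)
      then show ?case using commute_mult[of y "(g [^] i) [^] j" "g [^] i"] that insert.prems(2) by simp
    qed (use that in simp)
    then show ?thesis using insert.prems(2) by (simp add: nat_pow_pow)
  qed
  obtain i :: nat where i: "i > 0" "\<forall>x\<in>F. x \<otimes> g [^] i = g [^] i \<otimes> x" using insert by auto
  obtain j :: nat where j: "j > 0" "x \<otimes> g [^] j = g [^] j \<otimes> x" using insert.prems(3)[of x] by auto
  have "y \<otimes> g [^] (i * j) = g [^] (i * j) \<otimes> y" if "y \<in> insert x F" for y
  proof (cases "y = x")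
    case True
    then show ?thesis using pow[of x j i] j insert.prems(1) by (simp add: mult.commute)
  next
    case False
    then show ?thesis using pow[of y i j] i that insert.prems(1) by auto
  qed
  then show ?case using i(1) j(1) by (intro exI[of _ "i * j"]) simp
qed

text \<open>As \<open>y\<close> centralizes \<open>w\<close>, conjugation by \<open>y [^] n\<close>
  multiplies \<open>x\<close> by \<open>w [^] n\<close>. At \<open>n = k\<close> this gives
  \<open>w [^] k = \<one>\<close>, and torsion-freeness makes \<open>w\<close> trivial.\<close>

lemma (in group) commute_of_class_two:
  assumes tf: "torsion_free_group G" and xy: "x \<in> carrier G" "y \<in> carrier G"
    and w: "w \<in> carrier G" "conjugate G x y = w \<otimes> x" "w \<otimes> y = y \<otimes> w"
    and k: "(k::nat) > 0" "x \<otimes> y [^] k = y [^] k \<otimes> x"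
  shows "x \<otimes> y = y \<otimes> x"
proof -
  have "conjugate G x (y [^] n) = w [^] n \<otimes> x" for n :: nat
  proof (induction n)
    case 0
    then show ?case using xy by simp
  next
    case (Suc n)
    have "conjugate G w y = w" using w xy by (simp add: conjugate_eq_iff)
    then have wn: "conjugate G (w [^] n) y = w [^] n" using w xy by (simp add: conjugate_nat_pow)
    have "conjugate G x (y [^] Suc n) = conjugate G (conjugate G x (y [^] n)) y"
      using xy by (simp add: conjugate_conjugate)
    also have "\<dots> = w [^] n \<otimes> (w \<otimes> x)"
      unfolding Suc using w xy wn by (simp add: conjugate_mult)
    finally show ?case using w xy by (simp add: m_assoc)
  qed
  from this[of k] have "w [^] k \<otimes> x = x" using k(2) xy conjugate_eq_iff[of x "y [^] k"] by simp
  then have "w [^] k = \<one>" using w xy by (metis l_one nat_pow_closed one_closed right_cancel)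
  then have "w = \<one>" using tf w(1) k(1) unfolding torsion_free_group_def by blast
  then show ?thesis using w(2) xy by (simp add: conjugate_eq_iff)
qed

section \<open>The climb along the derived series\<close>

theorem theorem4p6:
  fixes G :: "('a, 'b) monoid_scheme"
  assumes "group G"
    and "finitely_generated_group G"
    and "torsion_free_group G"
    and "solvable G"
  shows "virtually_abelian G
    \<or> (\<exists>H. subgroup H (G\<lparr>carrier := derived G (carrier G)\<rparr>) \<and> G\<lparr>carrier := H\<rparr> \<cong> Z_infinity)
    \<or> (\<exists>H. subgroup H G \<and> proper_Gc_group (G\<lparr>carrier := H\<rparr>))"
proof (rule disjCI)
  interpret group G by fact
  note tf = \<open>torsion_free_group G\<close>
  assume neg: "\<not> ((\<exists>H. subgroup H (G\<lparr>carrier := derived G (carrier G)\<rparr>) \<and> G\<lparr>carrier := H\<rparr> \<cong> Z_infinity)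
    \<or> (\<exists>H. subgroup H G \<and> proper_Gc_group (G\<lparr>carrier := H\<rparr>)))"
  have D': "subgroup (derived G (carrier G)) G" by (simp add: derived_is_subgroup)
  have noZ: "\<not> G\<lparr>carrier := H\<rparr> \<cong> Z_infinity" if "subgroup H G" "H \<subseteq> derived G (carrier G)" for H
    using neg subgroup_incl[OF that(1) D' that(2)] by blast
  have noGc: "\<not> proper_Gc_group (G\<lparr>carrier := H\<rparr>)" if "subgroup H G" for H
    using neg that by blast
  have star: "\<exists>k::nat>0. b \<otimes>\<^bsub>G\<^esub> a [^]\<^bsub>G\<^esub> k = a [^]\<^bsub>G\<^esub> k \<otimes>\<^bsub>G\<^esub> b"
    if "a \<in> carrier G" "b \<in> carrier G"
      "\<And>i::int. b \<otimes>\<^bsub>G\<^esub> conjugate G b (a [^]\<^bsub>G\<^esub> i) = conjugate G b (a [^]\<^bsub>G\<^esub> i) \<otimes>\<^bsub>G\<^esub> b" for a b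
    by (rule commuting_conjugates.power_commutes[OF commuting_conjugatesI[OF that] tf noZ noGc])
  define D where "D n = (derived G ^^ n) (carrier G)" for n
  have D: "D n \<lhd> G" for n unfolding D_def by (rule derived_series_normal)
  \<comment> \<open>The invariant of the climb. It passes from \<open>Suc j\<close> to
    \<open>j\<close>, because \<open>D 0\<close> is the whole group and the series ends in the
    trivial group.\<close>
  define good where "good j \<longleftrightarrow> (\<exists>N. N \<lhd> G \<and> (\<forall>g\<in>carrier G. \<exists>k::nat>0. g [^]\<^bsub>G\<^esub> k \<in> N)
      \<and> (\<forall>x\<in>N \<inter> D j. \<forall>y\<in>N \<inter> D j. x \<otimes>\<^bsub>G\<^esub> y = y \<otimes>\<^bsub>G\<^esub> x))" for j
  have step: "good j" if goodS: "good (Suc j)" for j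
  proof -
    obtain N where N: "N \<lhd> G" and per: "\<forall>g\<in>carrier G. \<exists>k::nat>0. g [^]\<^bsub>G\<^esub> k \<in> N"
      and ab: "\<forall>x\<in>N \<inter> D (Suc j). \<forall>y\<in>N \<inter> D (Suc j). x \<otimes>\<^bsub>G\<^esub> y = y \<otimes>\<^bsub>G\<^esub> x"
      using goodS unfolding good_def by (elim exE conjE)
    interpret N: normal N G by fact
    interpret Dj: normal "D j" G by (rule D)
    define A where "A = N \<inter> D (Suc j)"
    have A: "A \<lhd> G" unfolding A_def by (rule normal_subgroup_intersect[OF N D])
    interpret A: normal A G by fact
    have DS: "D (Suc j) = derived G (D j)" by (simp add: D_def)
    have "D (Suc j) \<subseteq> derived G (carrier G)" unfolding DS by (rule mono_derived[OF Dj.subset])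
    then have "A \<subseteq> derived G (carrier G)" by (auto simp: A_def)
    then have noA: "\<not> G\<lparr>carrier := H\<rparr> \<cong> Z_infinity" if "subgroup H G" "H \<subseteq> A" for H
      using noZ that by blast
    have abA: "x \<otimes>\<^bsub>G\<^esub> y = y \<otimes>\<^bsub>G\<^esub> x" if "x \<in> A" "y \<in> A" for x y
      using ab that by (simp add: A_def)
    obtain X where X: "finite X" "X \<subseteq> A" "\<forall>x\<in>A. \<exists>k::nat>0. x [^]\<^bsub>G\<^esub> k \<in> generate G X"
      using finite_rank_or_Z_infinity[OF A.subgroup_axioms abA noA] .
    define C where "C = {c \<in> carrier G. \<forall>x\<in>A. c \<otimes>\<^bsub>G\<^esub> x = x \<otimes>\<^bsub>G\<^esub> c}"
    have C: "C \<lhd> G" unfolding C_def by (rule centralizer_normal[OF A])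
    interpret C: normal C G by fact
    \<comment> \<open>\<open>star\<close> is applied to each element of the finite set
      \<open>X\<close>, and a common exponent is taken. The resulting power of \<open>g\<close>
      centralizes the subgroup generated by \<open>X\<close>, and uniqueness of roots extends this
      to all of \<open>A\<close>.\<close>
    have perC: "\<exists>k::nat>0. g [^]\<^bsub>G\<^esub> k \<in> C" if g: "g \<in> carrier G" for g
    proof -
      have XG: "X \<subseteq> carrier G" using X(2) A.subset by blast
      have "\<exists>k::nat>0. x \<otimes>\<^bsub>G\<^esub> g [^]\<^bsub>G\<^esub> k = g [^]\<^bsub>G\<^esub> k \<otimes>\<^bsub>G\<^esub> x" if "x \<in> X" for x
      proof (rule star[OF g])
        show "x \<in> carrier G" using that XG by blast
        show "x \<otimes>\<^bsub>G\<^esub> conjugate G x (g [^]\<^bsub>G\<^esub> i) = conjugate G x (g [^]\<^bsub>G\<^esub> i) \<otimes>\<^bsub>G\<^esub> x" for i :: int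
          using that X(2) g normal_conjugate[OF A] by (intro abA) auto
      qed
      then obtain k :: nat where k: "k > 0" "\<forall>x\<in>X. x \<otimes>\<^bsub>G\<^esub> g [^]\<^bsub>G\<^esub> k = g [^]\<^bsub>G\<^esub> k \<otimes>\<^bsub>G\<^esub> x"
        using common_commuting_power[OF X(1) XG g] by blast
      have "g [^]\<^bsub>G\<^esub> k \<otimes>\<^bsub>G\<^esub> y = y \<otimes>\<^bsub>G\<^esub> g [^]\<^bsub>G\<^esub> k" if y: "y \<in> A" for y
      proof -
        obtain m :: nat where m: "m > 0" "y [^]\<^bsub>G\<^esub> m \<in> generate G X" using X(3) y by blast
        have "g [^]\<^bsub>G\<^esub> k \<otimes>\<^bsub>G\<^esub> y [^]\<^bsub>G\<^esub> m = y [^]\<^bsub>G\<^esub> m \<otimes>\<^bsub>G\<^esub> g [^]\<^bsub>G\<^esub> k"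
          by (rule generate_commute[OF XG _ _ m(2)]) (use g k(2) in auto)
        moreover have "y \<otimes>\<^bsub>G\<^esub> conjugate G y (g [^]\<^bsub>G\<^esub> k) = conjugate G y (g [^]\<^bsub>G\<^esub> k) \<otimes>\<^bsub>G\<^esub> y"
          using y g normal_conjugate[OF A] by (intro abA) auto
        ultimately show ?thesis
          using torsion_free_commute_pow[OF tf A.mem_carrier[OF y] nat_pow_closed[OF g] _ m(1)] by metis
      qed
      then have "g [^]\<^bsub>G\<^esub> k \<in> C" unfolding C_def using nat_pow_closed[OF g] by blast
      with k(1) show ?thesis by blast
    qed
    have "\<exists>k::nat>0. g [^]\<^bsub>G\<^esub> k \<in> N \<inter> C" if g: "g \<in> carrier G" for g
    proof -
      obtain k :: nat where k: "k > 0" "g [^]\<^bsub>G\<^esub> k \<in> N" using per g by blast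
      obtain l :: nat where l: "l > 0" "(g [^]\<^bsub>G\<^esub> k) [^]\<^bsub>G\<^esub> l \<in> C" using perC[of "g [^]\<^bsub>G\<^esub> k"] g by blast
      have "(g [^]\<^bsub>G\<^esub> k) [^]\<^bsub>G\<^esub> l \<in> N"
        using subgroup_int_pow_closed[OF N.subgroup_axioms k(2), of "int l"] by (simp only: int_pow_int)
      then show ?thesis using k(1) l g by (intro exI[of _ "k * l"]) (simp add: nat_pow_pow)
    qed
    moreover have "x \<otimes>\<^bsub>G\<^esub> y = y \<otimes>\<^bsub>G\<^esub> x" if x: "x \<in> N \<inter> C \<inter> D j" and y: "y \<in> N \<inter> C \<inter> D j" for x y
    proof -
      \<comment> \<open>\<open>N \<inter> C \<inter> D j\<close> is nilpotent of class at most two, since its commutators lie in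
        \<open>A\<close>, which \<open>C\<close> centralizes.\<close>
      have xy: "x \<in> carrier G" "y \<in> carrier G" using x y N.subset by auto
      \<comment> \<open>\<open>w g\<close> is the commutator by which conjugation with
        \<open>g\<close> moves \<open>x\<close>; for \<open>g\<close> in \<open>D j\<close> it lies
        in \<open>A\<close>.\<close>
      define w where "w g = conjugate G x g \<otimes>\<^bsub>G\<^esub> inv\<^bsub>G\<^esub> x" for g
      have wA: "w g \<in> A" if g: "g \<in> D j" for g
      proof -
        have gc: "g \<in> carrier G" using g Dj.subset by blast
        have "w g = inv\<^bsub>G\<^esub> g \<otimes>\<^bsub>G\<^esub> x \<otimes>\<^bsub>G\<^esub> inv\<^bsub>G\<^esub> (inv\<^bsub>G\<^esub> g) \<otimes>\<^bsub>G\<^esub> inv\<^bsub>G\<^esub> x"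
          using gc by (simp add: w_def conjugate_def)
        also have "\<dots> \<in> D (Suc j)"
          unfolding DS derived_def using x Dj.m_inv_closed[OF g] by (intro generate.incl) blast
        finally have "w g \<in> D (Suc j)" .
        moreover have "w g \<in> N" unfolding w_def using x normal_conjugate[OF N _ gc] by auto
        ultimately show ?thesis by (simp add: A_def)
      qed
      have conj: "conjugate G x g = w g \<otimes>\<^bsub>G\<^esub> x" if "g \<in> carrier G" for g
        using that xy by (simp add: w_def m_assoc)
      have "\<exists>k::nat>0. x \<otimes>\<^bsub>G\<^esub> y [^]\<^bsub>G\<^esub> k = y [^]\<^bsub>G\<^esub> k \<otimes>\<^bsub>G\<^esub> x"
      \<comment> \<open>Each conjugate of \<open>x\<close> by a power of \<open>y\<close> is an
        element of \<open>A\<close> times \<open>x\<close>, and \<open>x\<close> centralizes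
        \<open>A\<close>, so the hypothesis of \<open>star\<close> holds.\<close>
      proof (rule star[OF xy(2,1)])
        fix i :: int
        have "w (y [^]\<^bsub>G\<^esub> i) \<in> A"
          using y by (intro wA subgroup_int_pow_closed[OF Dj.subgroup_axioms]) simp
        moreover from this have "x \<otimes>\<^bsub>G\<^esub> w (y [^]\<^bsub>G\<^esub> i) = w (y [^]\<^bsub>G\<^esub> i) \<otimes>\<^bsub>G\<^esub> x"
          using x unfolding C_def by blast
        ultimately show "x \<otimes>\<^bsub>G\<^esub> conjugate G x (y [^]\<^bsub>G\<^esub> i) = conjugate G x (y [^]\<^bsub>G\<^esub> i) \<otimes>\<^bsub>G\<^esub> x"
          unfolding conj[OF int_pow_closed[OF xy(2)]] using xy(1) A.mem_carrier
          by (intro commute_mult HOL.refl) blast+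
      qed
      then obtain k :: nat where k: "k > 0" "x \<otimes>\<^bsub>G\<^esub> y [^]\<^bsub>G\<^esub> k = y [^]\<^bsub>G\<^esub> k \<otimes>\<^bsub>G\<^esub> x" by blast
      have "w y \<in> A" using y by (intro wA) simp
      moreover from this have "y \<otimes>\<^bsub>G\<^esub> w y = w y \<otimes>\<^bsub>G\<^esub> y" using y unfolding C_def by blast
      ultimately show ?thesis
        using commute_of_class_two[OF tf xy A.mem_carrier conj[OF xy(2)] _ k] by metis
    qed
    ultimately show ?thesis
      unfolding good_def using normal_subgroup_intersect[OF N C] by blast
  qed
  obtain n where "D n = {\<one>\<^bsub>G\<^esub>}"
    unfolding D_def using \<open>solvable G\<close> solvable_iff_trivial_derived_seq by blast
  \<comment> \<open>At the trivial term, the whole group serves as \<open>N\<close>.\<close>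
  then have "good n"
    unfolding good_def using normal_self by (intro exI[of _ "carrier G"]) (auto intro: exI[of _ 1])
  then have "good 0" by (induction n) (use step in auto)
  then obtain N where N: "N \<lhd> G" and per: "\<forall>g\<in>carrier G. \<exists>k::nat>0. g [^]\<^bsub>G\<^esub> k \<in> N"
    and ab: "\<forall>x\<in>N \<inter> D 0. \<forall>y\<in>N \<inter> D 0. x \<otimes>\<^bsub>G\<^esub> y = y \<otimes>\<^bsub>G\<^esub> x"
    unfolding good_def by (elim exE conjE)
  interpret N: normal N G by fact
  obtain S where "finite S" "S \<subseteq> carrier G" "generate G S = carrier G"
    using \<open>finitely_generated_group G\<close> unfolding finitely_generated_group_def by blast
  then have "finite (rcosets\<^bsub>G\<^esub> N)"
    using N.finite_rcosets_of_solvable_torsion_quotient[OF \<open>solvable G\<close>] per by blast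
  \<comment> \<open>\<open>D 0\<close> is the whole carrier, so commutativity on
    \<open>N \<inter> D 0\<close> is commutativity of \<open>N\<close>.\<close>
  moreover have "comm_group (G\<lparr>carrier := N\<rparr>)"
    by (rule group.group_comm_groupI[OF subgroup_imp_group[OF N.subgroup_axioms]])
      (use ab in \<open>simp add: D_def\<close>)
  ultimately show "virtually_abelian G"
    unfolding virtually_abelian_def using N.subgroup_axioms is_group by blast
qed

end
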